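(* For primes $p,q$ with $2<p<q$, the number $b(p^2q)$ of isomorphism classes of (left) braces of order $p^2q$ is $$b(p^2q)=\begin{cases}4 & \text{if } p\nmid q-1,\\ p+8 & \text{if } p\mid q-1 \text{ and } p^2\nmid q-1,\\ 2p+8 & \text{if } p^2\mid q-1.\end{cases}$$
   Context: A (left) brace is a (here finite) abelian group $(A,+)$ with a binary operation $\cdot$ such that for all $a,b,c\in A$: $a\cdot(b+c)=a\cdot b+a\cdot c$; $(a\cdot b+a+b)\cdot c=a\cdot(b\cdot c)+a\cdot c+b\cdot c$; and $x\mapsto a\cdot x+x$ is bijective. Isomorphisms of braces are bijections preserving $+$ and $\cdot$. The order of a brace is its cardinality, and $b(n)$ is the number of isomorphism classes of left braces of order $n$. *)

theory Defs
  imports "HOL-Algebra.Ring" "HOL-Computational_Algebra.Primes"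
begin

text \<open>Braces are carried by the ring record: \<open>\<oplus>\<close>, \<open>\<zero>\<close> form the additive group and \<open>\<otimes>\<close> is the
  second operation, which need be neither associative nor distributive on the right.  The field
  \<open>\<one>\<close> of the record is unconstrained, and isomorphisms ignore it.\<close>

locale left_brace = abelian_group A for A (structure) +
  assumes brace_mult_closed:
    "\<lbrakk>a \<in> carrier A; b \<in> carrier A\<rbrakk> \<Longrightarrow> a \<otimes> b \<in> carrier A"
  and brace_distrib:
    "\<lbrakk>a \<in> carrier A; b \<in> carrier A; c \<in> carrier A\<rbrakk> \<Longrightarrow>
      a \<otimes> (b \<oplus> c) = a \<otimes> b \<oplus> a \<otimes> c"
  and brace_circ:
    "\<lbrakk>a \<in> carrier A; b \<in> carrier A; c \<in> carrier A\<rbrakk> \<Longrightarrow>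
      (a \<otimes> b \<oplus> a \<oplus> b) \<otimes> c = a \<otimes> (b \<otimes> c) \<oplus> a \<otimes> c \<oplus> b \<otimes> c"
  and brace_bij:
    "a \<in> carrier A \<Longrightarrow> bij_betw (\<lambda>x. a \<otimes> x \<oplus> x) (carrier A) (carrier A)"

definition brace_iso :: "('a, 'm) ring_scheme \<Rightarrow> ('b, 'n) ring_scheme \<Rightarrow> ('a \<Rightarrow> 'b) set" where
  "brace_iso A B = {f. bij_betw f (carrier A) (carrier B) \<and>
     (\<forall>x\<in>carrier A. \<forall>y\<in>carrier A.
        f (x \<oplus>\<^bsub>A\<^esub> y) = f x \<oplus>\<^bsub>B\<^esub> f y \<and> f (x \<otimes>\<^bsub>A\<^esub> y) = f x \<otimes>\<^bsub>B\<^esub> f y)}"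

text \<open>Restricting to carriers inside \<^typ>\<open>nat\<close> loses no isomorphism class of finite braces; see
  \<open>nat_brace_representative\<close> below.\<close>

definition braces_of_order :: "nat \<Rightarrow> nat ring set" where
  "braces_of_order n = {A. left_brace A \<and> finite (carrier A) \<and> card (carrier A) = n}"

definition brace_isomorphic :: "nat \<Rightarrow> (nat ring \<times> nat ring) set" where
  "brace_isomorphic n =
     {(A, B). A \<in> braces_of_order n \<and> B \<in> braces_of_order n \<and> brace_iso A B \<noteq> {}}"

definition num_braces :: "nat \<Rightarrow> nat" where
  "num_braces n = card (braces_of_order n // brace_isomorphic n)"

lemma brace_iso_refl: "id \<in> brace_iso A A"
  by (simp add: brace_iso_def)

lemma brace_iso_trans:
  assumes "f \<in> brace_iso A B" "g \<in> brace_iso B C"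
  shows "g \<circ> f \<in> brace_iso A C"
proof -
  have "f x \<in> carrier B" if "x \<in> carrier A" for x
    using assms(1) that by (auto simp: brace_iso_def dest: bij_betwE)
  then show ?thesis
    using assms by (auto simp: brace_iso_def intro: bij_betw_trans)
qed

lemma brace_iso_sym:
  fixes A (structure)
  assumes "left_brace A" "f \<in> brace_iso A B"
  shows "inv_into (carrier A) f \<in> brace_iso B A"
proof -
  interpret left_brace A by fact
  let ?g = "inv_into (carrier A) f"
  have bij: "bij_betw f (carrier A) (carrier B)"
    using assms(2) by (simp add: brace_iso_def)
  have gA: "?g x \<in> carrier A" "f (?g x) = x" if "x \<in> carrier B" for x
    using bij that by (auto simp: bij_betw_def inv_into_into f_inv_into_f)
  have gf: "?g (f x) = x" if "x \<in> carrier A" for x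
    using bij that by (simp add: bij_betw_def)
  have "?g (x \<oplus>\<^bsub>B\<^esub> y) = ?g x \<oplus> ?g y \<and> ?g (x \<otimes>\<^bsub>B\<^esub> y) = ?g x \<otimes> ?g y"
    if "x \<in> carrier B" "y \<in> carrier B" for x y
  proof -
    have "f (?g x \<oplus> ?g y) = x \<oplus>\<^bsub>B\<^esub> y" "f (?g x \<otimes> ?g y) = x \<otimes>\<^bsub>B\<^esub> y"
      using assms(2) gA that by (simp_all add: brace_iso_def)
    moreover have "?g x \<oplus> ?g y \<in> carrier A" "?g x \<otimes> ?g y \<in> carrier A"
      using gA that by (simp_all add: brace_mult_closed)
    ultimately show ?thesis
      using gf by metis
  qed
  then show ?thesis
    using bij_betw_inv_into[OF bij] by (simp add: brace_iso_def)
qed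

lemma equiv_brace_isomorphic: "equiv (braces_of_order n) (brace_isomorphic n)"
proof (rule equivI)
  show "brace_isomorphic n \<subseteq> braces_of_order n \<times> braces_of_order n"
    by (auto simp: brace_isomorphic_def)
  show "refl_on (braces_of_order n) (brace_isomorphic n)"
    using brace_iso_refl by (auto simp: refl_on_def brace_isomorphic_def)
  show "sym (brace_isomorphic n)"
    using brace_iso_sym by (fastforce simp: sym_def brace_isomorphic_def braces_of_order_def)
  show "trans (brace_isomorphic n)"
    using brace_iso_trans by (fastforce simp: trans_def brace_isomorphic_def)
qed

lemma nat_brace_representative:
  fixes A :: "('a, 'm) ring_scheme" (structure)
  assumes "left_brace A" "finite (carrier A)"
  shows "\<exists>B \<in> braces_of_order (card (carrier A)). brace_iso A B \<noteq> {}"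
proof -
  interpret left_brace A by fact
  obtain f :: "'a \<Rightarrow> nat" where bij: "bij_betw f (carrier A) {..<card (carrier A)}"
    using ex_bij_betw_finite_nat[OF assms(2)] by (auto simp: lessThan_atLeast0)
  define g where "g = inv_into (carrier A) f"
  define B :: "nat ring" where
    "B = \<lparr>carrier = {..<card (carrier A)}, monoid.mult = (\<lambda>x y. f (g x \<otimes> g y)), one = 0,
          zero = f \<zero>, add = (\<lambda>x y. f (g x \<oplus> g y))\<rparr>"
  have fB: "f x < card (carrier A)" if "x \<in> carrier A" for x
    using bij that by (auto dest: bij_betwE)
  have gA: "g x \<in> carrier A" "f (g x) = x" if "x < card (carrier A)" for x
    using bij that by (auto simp: g_def bij_betw_def intro!: inv_into_into f_inv_into_f)
  have gf: "g (f x) = x" if "x \<in> carrier A" for x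
    using bij that by (simp add: g_def bij_betw_def)
  have bijg: "bij_betw g {..<card (carrier A)} (carrier A)"
    unfolding g_def by (rule bij_betw_inv_into[OF bij])
  have "abelian_group B"
  proof (rule abelian_groupI)
    fix x assume "x \<in> carrier B"
    then have x: "x < card (carrier A)" by (simp add: B_def)
    show "\<exists>y\<in>carrier B. y \<oplus>\<^bsub>B\<^esub> x = \<zero>\<^bsub>B\<^esub>"
      by (rule bexI[of _ "f (\<ominus> g x)"]) (use x in \<open>simp_all add: B_def fB gA gf l_neg\<close>)
  qed (simp_all add: B_def fB gA gf a_ac)
  moreover have "left_brace_axioms B"
  proof
    fix a b c assume "a \<in> carrier B" "b \<in> carrier B" "c \<in> carrier B"
    then show "a \<otimes>\<^bsub>B\<^esub> (b \<oplus>\<^bsub>B\<^esub> c) = a \<otimes>\<^bsub>B\<^esub> b \<oplus>\<^bsub>B\<^esub> a \<otimes>\<^bsub>B\<^esub> c"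
      and "(a \<otimes>\<^bsub>B\<^esub> b \<oplus>\<^bsub>B\<^esub> a \<oplus>\<^bsub>B\<^esub> b) \<otimes>\<^bsub>B\<^esub> c =
        a \<otimes>\<^bsub>B\<^esub> (b \<otimes>\<^bsub>B\<^esub> c) \<oplus>\<^bsub>B\<^esub> a \<otimes>\<^bsub>B\<^esub> c \<oplus>\<^bsub>B\<^esub> b \<otimes>\<^bsub>B\<^esub> c"
      by (simp_all add: B_def fB gA gf brace_mult_closed brace_distrib brace_circ)
  next
    fix a assume "a \<in> carrier B"
    then have a: "g a \<in> carrier A" by (simp add: B_def gA)
    have "bij_betw (f \<circ> ((\<lambda>x. g a \<otimes> x \<oplus> x) \<circ> g)) {..<card (carrier A)} {..<card (carrier A)}"
      using bij_betw_trans[OF bij_betw_trans[OF bijg brace_bij[OF a]] bij] .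
    moreover have "bij_betw (\<lambda>x. a \<otimes>\<^bsub>B\<^esub> x \<oplus>\<^bsub>B\<^esub> x) (carrier B) (carrier B) \<longleftrightarrow>
      bij_betw (f \<circ> ((\<lambda>x. g a \<otimes> x \<oplus> x) \<circ> g)) (carrier B) (carrier B)"
      by (rule bij_betw_cong) (use a in \<open>auto simp: B_def gA gf brace_mult_closed\<close>)
    ultimately show "bij_betw (\<lambda>x. a \<otimes>\<^bsub>B\<^esub> x \<oplus>\<^bsub>B\<^esub> x) (carrier B) (carrier B)"
      by (simp add: B_def)
  qed (simp add: B_def fB gA brace_mult_closed)
  ultimately have "B \<in> braces_of_order (card (carrier A))"
    by (simp add: braces_of_order_def left_brace_def) (simp add: B_def)
  moreover have "f \<in> brace_iso A B"
    using bij by (simp add: brace_iso_def B_def gf)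
  ultimately show ?thesis by blast
qed

end

theory Submission
  imports Defs "HOL-Algebra.Sylow" "HOL-Algebra.Group_Action"
    "HOL-Number_Theory.Residue_Primitive_Roots"
begin

text \<open>Let \<open>\<lambda>\<^sub>a x = a x + x\<close> and \<open>a \<circ> b = a + \<lambda>\<^sub>a b\<close>.  The Sylow subgroups \<open>P\<close> (order \<open>p\<^sup>2\<close>) and \<open>Q\<close>
  (order \<open>q\<close>) of the additive group are invariant under all \<open>\<lambda>\<^sub>a\<close>.  Counting fixed points of the
  \<open>q\<close>-group \<open>(Q, \<circ>)\<close> shows that \<open>Q\<close> acts trivially, and counting those of the \<open>p\<close>-group \<open>(P, \<circ>)\<close>
  yields \<open>h \<in> P\<close> of order \<open>p\<close> fixed by \<open>P\<close>.  Completing \<open>h\<close> by \<open>g \<in> P\<close> and a generator \<open>z\<close> of \<open>Q\<close>,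
  the brace is determined by the structure constants in
  \<open>p g = e h\<close>, \<open>\<lambda>\<^sub>g g = g + c h\<close>, \<open>\<lambda>\<^sub>g z = u z\<close>, \<open>\<lambda>\<^sub>h z = v z\<close>, where \<open>v\<^sup>p = 1\<close> and \<open>u\<^sup>p = v\<^sup>e\<close> modulo \<open>q\<close>;
  all such constants occur.  The isomorphism classes are therefore the orbits of the base changes
  \<open>g' = k g + m h\<close>, \<open>h' = l h\<close> (and of the exchange of \<open>g\<close> and \<open>h\<close> if \<open>e = c = 0\<close>) on the quadruples
  \<open>(e, c, u, v)\<close>.\<close>

section \<open>Fixed points of p-groups and the lambda action\<close>

text \<open>One brace has many adapted bases, so it is given the set \<open>basis_params\<close> of
  all tuples that it admits. The claim becomes that each such set meets \<open>normal_forms\<close>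
  in exactly one point; existence is by explicit base changes, uniqueness by comparing two bases of
  one brace. Uniqueness for c = 1 rests on a rigidity: \<lambda> of g' moves g' by h' itself, so h'
  must be c k^2 copies of h. For e = 0 the exponent of v is thus scaled only by squares, whence a
  nonsquare \<open>n\<close> and two classes with nontrivial v. For e = c = 1 the relation p g' = h'
  gives k = k^2, so k = 1 modulo p, and u changes only by powers of v: all roots u survive when v =
  1, and p - 1 classes with v = u^p nontrivial are added when p^2 divides q - 1. Oddness of p
  excludes q = p + 1, the one case in which Q could move P; it makes p divide p choose 2, so that
  the quadratic correction in \<open>chi\<close> vanishes at p copies of g; and it provides
  nonsquares.\<close>

lemma (in group_action) p_group_fixed_points:
  assumes "prime p" "order G = p ^ a" "finite E"
  shows "[card E = card {x \<in> E. \<forall>g \<in> carrier G. \<phi> g x = x}] (mod p)"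
proof -
  interpret group G
    using group_hom group_hom.axioms(1) by blast
  let ?F = "{x \<in> E. \<forall>g \<in> carrier G. \<phi> g x = x}"
  let ?C = "{orbit G \<phi> x | x. x \<in> E - ?F}"
  have orb_sub: "orbit G \<phi> x \<subseteq> E" if "x \<in> E" for x
    using that element_image unfolding orbit_def by blast
  have orb_self: "x \<in> orbit G \<phi> x" if "x \<in> E" for x
    using that orbit_refl by blast
  have fin: "finite (carrier G)"
    using assms by (metis card.infinite order_def power_not_zero not_prime_0)
  have orb_eq: "orbit G \<phi> y = orbit G \<phi> x" if "x \<in> E" "y \<in> orbit G \<phi> x" for x y
    using disjoint_union[of "orbit G \<phi> y" "orbit G \<phi> x"] orb_sub[of x] orb_self[of y] that
    unfolding orbits_def by blast
  \<comment> \<open>An orbit size divides \<open>p ^ a\<close>, and size 1 would make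
    \<open>x\<close> a fixed point. The non-fixed points are then a disjoint union of orbits of size
    divisible by p.\<close>
  have card_orb: "p dvd card (orbit G \<phi> x)" if "x \<in> E - ?F" for x
  proof -
    have "card (orbit G \<phi> x) * card (stabilizer G \<phi> x) = p ^ a"
      using orbit_stabilizer_theorem[of x] that assms(2) by simp
    then have "card (orbit G \<phi> x) dvd p ^ a" by (metis dvd_triv_left)
    then obtain k where k: "card (orbit G \<phi> x) = p ^ k"
      using divides_primepow_nat[OF assms(1)] by auto
    moreover have "k \<noteq> 0"
    proof
      assume "k = 0"
      then obtain y where "orbit G \<phi> x = {y}"
        using k by (auto simp: card_Suc_eq card_1_singleton_iff)
      then have "orbit G \<phi> x = {x}" using orb_self[of x] that by auto
      then have "\<forall>g \<in> carrier G. \<phi> g x = x" unfolding orbit_def by blast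
      then show False using that by auto
    qed
    ultimately show ?thesis by simp
  qed
  have "E - ?F = \<Union>?C"
  proof
    show "E - ?F \<subseteq> \<Union>?C" using orb_self by blast
    show "\<Union>?C \<subseteq> E - ?F"
    proof
      fix y assume "y \<in> \<Union>?C"
      then obtain x where x: "x \<in> E - ?F" "y \<in> orbit G \<phi> x" by blast
      have "y \<in> E" using x orb_sub by blast
      moreover have "y \<notin> ?F"
      proof
        assume "y \<in> ?F"
        then have "orbit G \<phi> y = {y}" unfolding orbit_def using one_closed by force
        then have "orbit G \<phi> x = {y}" using orb_eq x by blast
        then have "x = y" using orb_self x by blast
        then show False using x \<open>y \<in> ?F\<close> by blast
      qed
      ultimately show "y \<in> E - ?F" by blast
    qed
  qed
  moreover have "card (\<Union>?C) = sum card ?C"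
  proof (rule card_Union_disjoint)
    show "pairwise disjnt ?C"
      unfolding pairwise_def disjnt_def using orb_eq by blast
    show "finite c" if "c \<in> ?C" for c
      using that orb_sub assms(3) by (auto intro: finite_subset)
  qed
  moreover have "p dvd sum card ?C"
    by (rule dvd_sum) (use card_orb in auto)
  ultimately have "p dvd card (E - ?F)" by metis
  moreover have "card E = card (E - ?F) + card ?F"
    using assms(3) by (subst card_Diff_subset) (auto simp: card_mono)
  ultimately show ?thesis by (simp add: cong_def mod_add_eq [symmetric])
qed

section \<open>The lambda action and the circle group of a left ideal\<close>

context left_brace
begin

definition lam :: "'a \<Rightarrow> 'a \<Rightarrow> 'a"
  where "lam a x = a \<otimes> x \<oplus> x"

definition circ_group :: "'a set \<Rightarrow> 'a monoid"
  where "circ_group L = \<lparr>carrier = L, monoid.mult = (\<lambda>x y. x \<oplus> lam x y), one = \<zero>\<rparr>"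

definition left_ideal :: "'a set \<Rightarrow> bool"
  where "left_ideal L \<longleftrightarrow> subgroup L (add_monoid A) \<and> (\<forall>a\<in>carrier A. \<forall>x\<in>L. lam a x \<in> L)"

lemma lam_closed [simp, intro]: "a \<in> carrier A \<Longrightarrow> x \<in> carrier A \<Longrightarrow> lam a x \<in> carrier A"
  by (simp add: lam_def brace_mult_closed)

lemma lam_add:
  "a \<in> carrier A \<Longrightarrow> x \<in> carrier A \<Longrightarrow> y \<in> carrier A \<Longrightarrow> lam a (x \<oplus> y) = lam a x \<oplus> lam a y"
  by (simp add: lam_def brace_mult_closed brace_distrib a_ac)

lemma lam_inj:
  "a \<in> carrier A \<Longrightarrow> x \<in> carrier A \<Longrightarrow> y \<in> carrier A \<Longrightarrow> lam a x = lam a y \<Longrightarrow> x = y"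
  using brace_bij[of a] unfolding lam_def bij_betw_def inj_on_def by blast

lemma lam_zero [simp]: "a \<in> carrier A \<Longrightarrow> lam a \<zero> = \<zero>"
  using lam_add[of a \<zero> \<zero>] lam_closed[of a \<zero>]
  by (metis add.l_cancel_one' l_zero zero_closed)

text \<open>The second brace axiom read through \<open>lam\<close>: as
  \<open>a \<oplus> lam a b\<close> is \<open>a \<otimes> b \<oplus> a \<oplus> b\<close>, it says
  that \<lambda> turns the circle operation into composition.\<close>

lemma lam_circ:
  assumes "a \<in> carrier A" "b \<in> carrier A" "x \<in> carrier A"
  shows "lam (a \<oplus> lam a b) x = lam a (lam b x)"
proof -
  have "a \<oplus> lam a b = a \<otimes> b \<oplus> a \<oplus> b"
    using assms by (simp add: lam_def brace_mult_closed a_ac)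
  then have "lam (a \<oplus> lam a b) x = (a \<otimes> b \<oplus> a \<oplus> b) \<otimes> x \<oplus> x"
    by (simp only: lam_def)
  also have "\<dots> = a \<otimes> (b \<otimes> x) \<oplus> a \<otimes> x \<oplus> b \<otimes> x \<oplus> x"
    using assms by (simp only: brace_circ)
  also have "\<dots> = lam a (lam b x)"
    using assms by (simp add: lam_def brace_mult_closed brace_distrib a_ac)
  finally show ?thesis .
qed

text \<open>Zero is idempotent for the circle operation, so \<open>lam \<zero>\<close> is an
  idempotent injection.\<close>

lemma lam_of_zero [simp]: "x \<in> carrier A \<Longrightarrow> lam \<zero> x = x"
  using lam_circ[of \<zero> \<zero> x] lam_inj[of \<zero> "lam \<zero> x" x] by simp

lemma lam_nat_pow:
  "a \<in> carrier A \<Longrightarrow> x \<in> carrier A \<Longrightarrow> lam a ([(n::nat)] \<cdot> x) = [n] \<cdot> lam a x"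
  by (induction n) (simp_all add: lam_add)

lemma left_ideal_subset: "left_ideal L \<Longrightarrow> L \<subseteq> carrier A"
  using subgroup.subset[of L "add_monoid A"] by (simp add: left_ideal_def)

text \<open>Finiteness supplies inverses: the injection \<open>lam x\<close> permutes the finite set
  \<open>L\<close>, so it takes the value \<open>\<ominus> x\<close> there.\<close>

lemma circ_group_group:
  assumes L: "left_ideal L" and fin: "finite L"
  shows "group (circ_group L)"
proof -
  have sub: "x \<in> carrier A" if "x \<in> L" for x using left_ideal_subset[OF L] that by blast
  have add: "x \<oplus> y \<in> L" if "x \<in> L" "y \<in> L" for x y
    using L that subgroup.m_closed[of L "add_monoid A" x y] by (simp add: left_ideal_def)
  have lamL: "lam x y \<in> L" if "x \<in> L" "y \<in> L" for x y
    using L that sub by (simp add: left_ideal_def)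
  have zero: "\<zero> \<in> L"
    using L subgroup.one_closed[of L "add_monoid A"] by (simp add: left_ideal_def)
  have neg: "\<ominus> x \<in> L" if "x \<in> L" for x
    using L that subgroup.m_inv_closed[of L "add_monoid A" x] by (simp add: left_ideal_def a_inv_def)
  have rinv: "\<exists>y\<in>L. x \<oplus> lam x y = \<zero>" if x: "x \<in> L" for x
  proof -
    have "inj_on (lam x) L"
      using lam_inj[OF sub[OF x]] sub by (simp add: inj_on_def)
    moreover have "lam x ` L \<subseteq> L"
      using lamL[OF x] by blast
    ultimately have "lam x ` L = L"
      by (rule endo_inj_surj[OF fin, rotated])
    then obtain y where "y \<in> L" "lam x y = \<ominus> x"
      using neg[OF x] by (metis imageE)
    then have "y \<in> L" "x \<oplus> lam x y = \<zero>"
      using r_neg[OF sub[OF x]] by simp_all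
    then show ?thesis by blast
  qed
  have assoc: "(x \<oplus> lam x y) \<oplus> lam (x \<oplus> lam x y) w = x \<oplus> lam x (y \<oplus> lam y w)"
    if "x \<in> L" "y \<in> L" "w \<in> L" for x y w
    using that sub by (simp add: lam_circ lam_add a_assoc)
  show ?thesis
  proof (rule groupI)
    fix x assume "x \<in> carrier (circ_group L)"
    then have x: "x \<in> L" by (simp add: circ_group_def)
    \<comment> \<open>\<open>groupI\<close> asks for a left inverse; inverting twice shows that
      \<open>w\<close> is \<open>x\<close>, so the right inverse \<open>y\<close> is also a left
      inverse.\<close>
    obtain y where y: "y \<in> L" "x \<oplus> lam x y = \<zero>" using rinv[OF x] by blast
    obtain w where w: "w \<in> L" "y \<oplus> lam y w = \<zero>" using rinv[OF y(1)] by blast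
    have "x = w" using assoc[OF x y(1) w(1)] y w x sub by simp
    then show "\<exists>y\<in>carrier (circ_group L). y \<otimes>\<^bsub>circ_group L\<^esub> x = \<one>\<^bsub>circ_group L\<^esub>"
      using y w by (auto simp: circ_group_def)
  qed (use add lamL zero assoc sub in \<open>auto simp: circ_group_def\<close>)
qed

lemma lam_circ_pow:
  assumes "left_ideal L" "finite L" "a \<in> L" "x \<in> carrier A"
  shows "lam (a [^]\<^bsub>circ_group L\<^esub> n) x = (lam a ^^ n) x \<and> a [^]\<^bsub>circ_group L\<^esub> n \<in> L"
proof -
  interpret C: group "circ_group L" by (rule circ_group_group) fact+
  have car: "a [^]\<^bsub>circ_group L\<^esub> n \<in> L" for n :: nat
    using C.nat_pow_closed[of a n] assms(3) by (simp add: circ_group_def)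
  have sub: "y \<in> carrier A" if "y \<in> L" for y using left_ideal_subset[OF assms(1)] that by blast
  have "lam (a [^]\<^bsub>circ_group L\<^esub> n) x = (lam a ^^ n) x"
    using assms(4)
  proof (induction n arbitrary: x)
    case 0
    then show ?case by (simp add: C.nat_pow_0) (simp add: circ_group_def)
  next
    case (Suc n)
    have "lam (a [^]\<^bsub>circ_group L\<^esub> Suc n) x = lam (a [^]\<^bsub>circ_group L\<^esub> n) (lam a x)"
      using Suc.prems car sub assms(3) by (simp add: circ_group_def lam_circ)
    also have "\<dots> = (lam a ^^ n) (lam a x)"
      using Suc sub assms(3) by simp
    finally show ?case by (simp only: funpow_Suc_right o_apply)
  qed
  with car show ?thesis by blast
qed

text \<open>Lagrange in the circle group of \<open>L\<close>, transported to iterates of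
  \<open>lam a\<close>. It later forces the diagonal entry of \<lambda> on P to be 1 modulo
  p.\<close>

lemma lam_funpow_card:
  assumes "left_ideal L" "finite L" "a \<in> L" "x \<in> carrier A"
  shows "(lam a ^^ card L) x = x"
proof -
  interpret C: group "circ_group L" by (rule circ_group_group) fact+
  have "a [^]\<^bsub>circ_group L\<^esub> card L = \<zero>"
    using C.pow_order_eq_1[of a] assms(3) by (simp add: circ_group_def order_def)
  then show ?thesis using lam_circ_pow[OF assms, of "card L"] assms by simp
qed

lemma lam_fixed_points:
  assumes L: "left_ideal L" "prime p" "card L = p ^ a"
    and E: "finite E" "E \<subseteq> carrier A" "\<And>a x. a \<in> L \<Longrightarrow> x \<in> E \<Longrightarrow> lam a x \<in> E"
  shows "[card E = card {x \<in> E. \<forall>a \<in> L. lam a x = x}] (mod p)"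
proof -
  have fin: "finite L"
    using L by (metis card.infinite power_not_zero not_prime_0)
  have sub: "x \<in> carrier A" if "x \<in> L" for x using left_ideal_subset[OF L(1)] that by blast
  have bij: "restrict (lam x) E \<in> Bij E" if "x \<in> L" for x
  proof -
    have inj: "inj_on (lam x) E"
      using E(2) lam_inj sub[OF that] by (meson inj_onI subsetD)
    have "lam x ` E = E"
      by (rule endo_inj_surj[OF E(1)]) (use inj E(3) that in auto)
    with inj show ?thesis
      by (auto simp: Bij_def bij_betw_def inj_on_def)
  qed
  \<comment> \<open>\<open>restrict\<close> is needed because \<open>Bij E\<close> contains only
    functions that are undefined outside \<open>E\<close>.\<close>
  interpret group_action "circ_group L" E "\<lambda>a. restrict (lam a) E"
  proof (unfold group_action_def group_hom_def group_hom_axioms_def, intro conjI)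
    show "group (circ_group L)" by (rule circ_group_group) fact+
    show "group (BijGroup E)" by (rule group_BijGroup)
    show "(\<lambda>a. restrict (lam a) E) \<in> hom (circ_group L) (BijGroup E)"
    proof (rule homI)
      fix x y assume "x \<in> carrier (circ_group L)" "y \<in> carrier (circ_group L)"
      then have xy: "x \<in> L" "y \<in> L" by (simp_all add: circ_group_def)
      show "restrict (lam (x \<otimes>\<^bsub>circ_group L\<^esub> y)) E =
        restrict (lam x) E \<otimes>\<^bsub>BijGroup E\<^esub> restrict (lam y) E"
        using bij[OF xy(1)] bij[OF xy(2)] xy sub E
        by (auto simp: circ_group_def BijGroup_def compose_def lam_circ subset_iff fun_eq_iff)
    qed (use bij in \<open>simp add: circ_group_def BijGroup_def\<close>)
  qed
  have "{x \<in> E. \<forall>g\<in>carrier (circ_group L). restrict (lam g) E x = x} =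
    {x \<in> E. \<forall>a \<in> L. lam a x = x}"
    by (auto simp: circ_group_def)
  then show ?thesis
    using p_group_fixed_points[of p a] L E(1) by (simp add: order_def circ_group_def)
qed

end

section \<open>Adapted bases\<close>

text \<open>Reduction of the coordinates of \<open>[i] g + [j] h + [k] z\<close>; the relation \<open>[p] g = [e] h\<close> causes a carry.\<close>

definition reduce :: "nat \<Rightarrow> nat \<Rightarrow> nat \<Rightarrow> nat \<times> nat \<times> nat \<Rightarrow> nat \<times> nat \<times> nat"
  where "reduce e p q = (\<lambda>(i, j, k). (i mod p, (j + e * (i div p)) mod p, k mod q))"

text \<open>The scalar by which \<open>\<lambda>\<close> of \<open>[i] g + [j] h\<close> acts on \<open>z\<close>, namely \<open>u ^ i * v ^ (j - c * (i choose 2))\<close>.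
  Since \<open>v\<^sup>p = 1\<close>, the factor \<open>p - 1\<close> can replace \<open>-1\<close>,
  which keeps all exponents natural.\<close>

definition chi :: "nat \<Rightarrow> nat \<Rightarrow> nat \<Rightarrow> nat \<Rightarrow> nat \<Rightarrow> nat \<Rightarrow> nat"
  where "chi p c u v i j = u ^ i * v ^ (j + (p - 1) * c * (i choose 2))"

text \<open>For \<open>e = 0\<close> the Sylow \<open>p\<close>-subgroup is elementary abelian, for \<open>e = 1\<close> it is cyclic.\<close>

locale adapted_brace = left_brace A for A (structure) +
  fixes p q e c u v :: nat and g h z
  assumes prime_p: "prime p" and prime_q: "prime q" and p_gt_2: "2 < p" and p_less_q: "p < q"
    and card_carrier: "card (carrier A) = p\<^sup>2 * q"
    and g_closed [simp]: "g \<in> carrier A" and h_closed [simp]: "h \<in> carrier A"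
    and z_closed [simp]: "z \<in> carrier A"
    and pg: "[p] \<cdot> g = [e] \<cdot> h" and ph: "[p] \<cdot> h = \<zero>" and qz: "[q] \<cdot> z = \<zero>"
    and lam_gg: "lam g g = g \<oplus> [c] \<cdot> h" and lam_gh: "lam g h = h" and lam_gz: "lam g z = [u] \<cdot> z"
    and lam_hg: "lam h g = g" and lam_hh: "lam h h = h" and lam_hz: "lam h z = [v] \<cdot> z"
    and lam_zg: "lam z g = g" and lam_zh: "lam z h = h" and lam_zz: "lam z z = z"
    and generated: "\<And>x. x \<in> carrier A \<Longrightarrow> \<exists>(i::nat) (j::nat) (k::nat). x = [i] \<cdot> g \<oplus> [j] \<cdot> h \<oplus> [k] \<cdot> z"
begin

section \<open>Coordinates with respect to an adapted basis\<close>

definition comb :: "nat \<Rightarrow> nat \<Rightarrow> nat \<Rightarrow> 'a"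
  where "comb i j k = [i] \<cdot> g \<oplus> [j] \<cdot> h \<oplus> [k] \<cdot> z"

lemma p_pos [simp]: "0 < p" and q_pos [simp]: "0 < q"
  using prime_p prime_q prime_gt_0_nat by blast+

lemma comb_closed [simp]: "comb i j k \<in> carrier A"
  by (simp add: comb_def)

lemma comb_exhaust:
  assumes "x \<in> carrier A"
  obtains i j k where "x = comb i j k"
proof -
  have "\<exists>i j k. x = comb i j k"
    unfolding comb_def using assms by (rule generated)
  with that show thesis by blast
qed

lemma comb_add: "comb i j k \<oplus> comb i' j' k' = comb (i + i') (j + j') (k + k')"
  by (simp add: comb_def add.nat_pow_mult [symmetric] a_ac)

lemma comb_nat_pow: "[(n::nat)] \<cdot> comb i j k = comb (n * i) (n * j) (n * k)"
  by (simp add: comb_def add.nat_pow_distrib add.nat_pow_pow mult.commute)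

lemma comb_g: "g = comb 1 0 0" and comb_h: "h = comb 0 1 0" and comb_z: "z = comb 0 0 1"
  and comb_0: "comb 0 0 0 = \<zero>"
  by (simp_all add: comb_def)

lemma nat_pow_h_mod: "[(j::nat)] \<cdot> h = [(j mod p)] \<cdot> h"
proof -
  have "[(j::nat)] \<cdot> h = [(p * (j div p))] \<cdot> h \<oplus> [(j mod p)] \<cdot> h"
    by (simp add: add.nat_pow_mult)
  also have "[(p * (j div p))] \<cdot> h = [(j div p)] \<cdot> ([p] \<cdot> h)"
    by (simp add: add.nat_pow_pow)
  finally show ?thesis by (simp add: ph)
qed

lemma nat_pow_z_mod: "[(j::nat)] \<cdot> z = [(j mod q)] \<cdot> z"
proof -
  have "[(j::nat)] \<cdot> z = [(q * (j div q))] \<cdot> z \<oplus> [(j mod q)] \<cdot> z"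
    by (simp add: add.nat_pow_mult)
  also have "[(q * (j div q))] \<cdot> z = [(j div q)] \<cdot> ([q] \<cdot> z)"
    by (simp add: add.nat_pow_pow)
  finally show ?thesis by (simp add: qz)
qed

lemma nat_pow_g: "[(i::nat)] \<cdot> g = [(i mod p)] \<cdot> g \<oplus> [(e * (i div p))] \<cdot> h"
proof -
  have "[(i::nat)] \<cdot> g = [(i mod p)] \<cdot> g \<oplus> [(p * (i div p))] \<cdot> g"
    by (simp add: add.nat_pow_mult)
  also have "[(p * (i div p))] \<cdot> g = [(i div p)] \<cdot> ([p] \<cdot> g)"
    by (simp add: add.nat_pow_pow)
  finally show ?thesis by (simp add: pg add.nat_pow_pow)
qed

lemma comb_reduce: "comb i j k = (\<lambda>(i, j, k). comb i j k) (reduce e p q (i, j, k))"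
proof -
  have "[((j + e * (i div p)) mod p)] \<cdot> h = [j] \<cdot> h \<oplus> [(e * (i div p))] \<cdot> h"
    by (simp only: nat_pow_h_mod [symmetric] add.nat_pow_mult h_closed)
  then have "comb i j k = comb (i mod p) ((j + e * (i div p)) mod p) (k mod q)"
    unfolding comb_def nat_pow_g [of i] nat_pow_z_mod [of k] by (simp add: a_ac)
  then show ?thesis by (simp add: reduce_def)
qed

lemma reduce_in: "reduce e p q x \<in> {..<p} \<times> {..<p} \<times> {..<q}"
  by (cases x) (simp add: reduce_def)

lemma comb_surj: "(\<lambda>(i, j, k). comb i j k) ` ({..<p} \<times> {..<p} \<times> {..<q}) = carrier A"
proof
  show "carrier A \<subseteq> (\<lambda>(i, j, k). comb i j k) ` ({..<p} \<times> {..<p} \<times> {..<q})"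
  proof
    fix x assume "x \<in> carrier A"
    then obtain i j k where "x = comb i j k"
      by (rule comb_exhaust)
    with comb_reduce [of i j k] have "x = (\<lambda>(i, j, k). comb i j k) (reduce e p q (i, j, k))"
      by (rule trans [rotated])
    then show "x \<in> (\<lambda>(i, j, k). comb i j k) ` ({..<p} \<times> {..<p} \<times> {..<q})"
      by (rule image_eqI [OF _ reduce_in])
  qed
qed auto

text \<open>Independence of the basis comes from counting: a surjection from p^2 q triples onto a
  carrier of that size is injective.\<close>

lemma comb_inj: "inj_on (\<lambda>(i, j, k). comb i j k) ({..<p} \<times> {..<p} \<times> {..<q})"
  by (rule eq_card_imp_inj_on)
    (simp_all add: comb_surj card_carrier card_cartesian_product power2_eq_square)

lemma comb_eq_iff:
  "comb i j k = comb i' j' k' \<longleftrightarrow> reduce e p q (i, j, k) = reduce e p q (i', j', k')"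
  by (subst comb_reduce [of i j k], subst comb_reduce [of i' j' k'],
      rule inj_on_eq_iff [OF comb_inj reduce_in reduce_in])

lemma comb_0_eq_iff: "comb 0 j k = comb 0 j' k' \<longleftrightarrow> [j = j'] (mod p) \<and> [k = k'] (mod q)"
  by (simp add: comb_eq_iff reduce_def cong_def)

lemma comb_same_iff: "comb i j k = comb i j' k' \<longleftrightarrow> [j = j'] (mod p) \<and> [k = k'] (mod q)"
proof -
  have "comb i j k = comb 0 j k \<oplus> comb i 0 0" "comb i j' k' = comb 0 j' k' \<oplus> comb i 0 0"
    by (simp_all add: comb_add)
  then have "comb i j k = comb i j' k' \<longleftrightarrow> comb 0 j k = comb 0 j' k'"
    using add.right_cancel[of "comb i 0 0" "comb 0 j k" "comb 0 j' k'"] by simp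
  then show ?thesis by (simp add: comb_0_eq_iff)
qed

lemma comb_p: "comb (p * i) j k = comb 0 (j + e * i) k"
  by (simp add: comb_eq_iff reduce_def)

lemma finite_carrier: "finite (carrier A)"
  using comb_surj by (metis finite_SigmaI finite_imageI finite_lessThan)

lemma lam_comb_gen:
  assumes "a \<in> carrier A"
  shows "lam a (comb i j k) = [i] \<cdot> lam a g \<oplus> [j] \<cdot> lam a h \<oplus> [k] \<cdot> lam a z"
  using assms by (simp add: comb_def lam_add lam_nat_pow)

lemma lam_g_comb: "lam g (comb i j k) = comb i (j + c * i) (u * k)"
  by (simp add: lam_comb_gen lam_gg lam_gh lam_gz)
    (simp add: comb_def add.nat_pow_distrib add.nat_pow_pow add.nat_pow_mult [symmetric] a_ac)

lemma lam_h_comb: "lam h (comb i j k) = comb i j (v * k)"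
  by (simp add: lam_comb_gen lam_hg lam_hh lam_hz) (simp add: comb_def add.nat_pow_pow)

lemma lam_z_comb: "lam z (comb i j k) = comb i j k"
  by (simp add: lam_comb_gen lam_zg lam_zh lam_zz) (simp add: comb_def)

lemma lam_zpow_comb: "lam (comb 0 0 n) (comb i j k) = comb i j k"
proof (induction n arbitrary: i j k)
  case (Suc n)
  have "lam (comb 0 0 n) z = z"
    using Suc [of 0 0 1] by (simp add: comb_def)
  then have "comb 0 0 (Suc n) = comb 0 0 n \<oplus> lam (comb 0 0 n) z"
    by (simp add: comb_def)
  then show ?case
    using Suc by (simp add: lam_circ lam_z_comb)
qed (simp add: comb_0)

lemma lam_hpow_comb: "lam (comb 0 n 0) (comb i j k) = comb i j (v ^ n * k)"
proof (induction n arbitrary: i j k)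
  case (Suc n)
  have "lam (comb 0 n 0) h = h"
    using Suc [of 0 1 0] by (simp add: comb_def)
  then have "comb 0 (Suc n) 0 = comb 0 n 0 \<oplus> lam (comb 0 n 0) h"
    by (simp add: comb_def)
  then show ?case
    using Suc by (simp add: lam_circ lam_h_comb mult_ac)
qed (simp add: comb_0)

lemma v_pow_p: "[v ^ p = 1] (mod q)"
proof -
  have "lam (comb 0 p 0) (comb 0 0 1) = lam (comb 0 0 0) (comb 0 0 1)"
    using comb_0_eq_iff[of p 0 0 0] by (simp add: cong_def)
  then show ?thesis by (simp only: lam_hpow_comb comb_0_eq_iff) simp
qed

lemma v_pow_p_mult: "[v ^ (p * n) = 1] (mod q)"
  using cong_pow[OF v_pow_p, of n] by (simp add: power_mult)

text \<open>The element (n+1) g + c n h is both (n g) \<circ> g and (c n h) \<circ> ((n+1) g).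
  Comparing the two and undoing the action of c n h gives a recursion; summing the terms c n yields
  the binomial coefficient in \<open>chi\<close>.\<close>

lemma lam_gpow_comb:
  "lam (comb n 0 0) (comb i j k) = comb i (j + c * n * i) (chi p c u v n 0 * k)"
proof (induction n arbitrary: i j k)
  case 0
  then show ?case by (simp add: comb_0 chi_def numeral_2_eq_2)
next
  case (Suc n)
  \<comment> \<open>\<open>?m\<close> copies of h undo the action of \<open>c * n\<close> copies,
    since together they make a multiple of p.\<close>
  let ?m = "(p - 1) * c * n"
  have "comb 0 (c * n) 0 \<oplus> lam (comb 0 (c * n) 0) (comb (Suc n) 0 0) = comb (Suc n) (c * n) 0"
    by (simp add: lam_hpow_comb comb_add)
  also have "\<dots> = comb n 0 0 \<oplus> lam (comb n 0 0) g"
    using Suc [of 1 0 0] by (simp only: comb_g [symmetric]) (simp add: comb_def a_ac)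
  finally have "lam (comb 0 (c * n) 0) (lam (comb (Suc n) 0 0) x) = lam (comb n 0 0) (lam g x)"
    if "x \<in> carrier A" for x
    using that by (metis lam_circ comb_closed g_closed)
  from this[of "comb i j k"]
  have *: "lam (comb 0 (c * n) 0) (lam (comb (Suc n) 0 0) (comb i j k)) =
      comb i (j + c * i + c * n * i) (chi p c u v n 0 * (u * k))"
    by (simp add: Suc lam_g_comb)
  obtain i' j' k' where ijk: "lam (comb (Suc n) 0 0) (comb i j k) = comb i' j' k'"
    by (rule comb_exhaust [of "lam (comb (Suc n) 0 0) (comb i j k)"]) auto
  have "?m + c * n = p * (c * n)"
    using p_pos by (cases p) (auto simp: algebra_simps)
  then have "v ^ ?m * (v ^ (c * n) * k') = v ^ (p * (c * n)) * k'"
    by (metis mult.assoc power_add)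
  then have "[v ^ ?m * (v ^ (c * n) * k') = k'] (mod q)"
    using cong_mult [OF v_pow_p_mult [of "c * n"] cong_refl [of k' q]] by (simp only: mult_1_left)
  then have "comb i' j' k' = lam (comb 0 ?m 0) (lam (comb 0 (c * n) 0) (comb i' j' k'))"
    by (simp only: lam_hpow_comb comb_same_iff) (simp add: cong_sym)
  also have "\<dots> = comb i (j + c * i + c * n * i) (v ^ ?m * (chi p c u v n 0 * (u * k)))"
    using * ijk by (simp add: lam_hpow_comb)
  also have "v ^ ?m * (chi p c u v n 0 * (u * k)) = chi p c u v (Suc n) 0 * k"
    by (simp add: chi_def numeral_2_eq_2 power_add [symmetric] algebra_simps)
  finally show ?case using ijk by (simp add: algebra_simps)
qed

lemma lam_comb:
  "lam (comb a b d) (comb i j k) = comb i (j + c * a * i) (chi p c u v a b * k)"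
proof -
  have "comb a b 0 = comb 0 b 0 \<oplus> lam (comb 0 b 0) (comb a 0 0)"
    by (simp add: lam_hpow_comb comb_add)
  then have 1: "lam (comb a b 0) x = lam (comb 0 b 0) (lam (comb a 0 0) x)"
    if "x \<in> carrier A" for x using that by (simp add: lam_circ)
  have "comb a b d = comb 0 0 d \<oplus> lam (comb 0 0 d) (comb a b 0)"
    by (simp add: lam_zpow_comb comb_add)
  then have "lam (comb a b d) (comb i j k) = lam (comb 0 0 d) (lam (comb a b 0) (comb i j k))"
    by (simp only: lam_circ comb_closed)
  then have "lam (comb a b d) (comb i j k) = comb i (j + c * a * i) (v ^ b * (chi p c u v a 0 * k))"
    by (simp add: 1 lam_hpow_comb lam_gpow_comb lam_zpow_comb)
  then show ?thesis
    by (simp add: chi_def power_add mult_ac)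
qed

lemma p_dvd_choose: "p dvd p choose 2"
  using dvd_choose_prime[of 2 p] prime_p p_gt_2 by simp

text \<open>p g and e h are the same element, so their scalars on z agree; as p is odd it divides p
  choose 2, and the correction factor in \<open>chi\<close> is trivial.\<close>

lemma u_pow_p: "[u ^ p = v ^ e] (mod q)"
proof -
  have "comb p 0 0 = comb 0 e 0" using comb_p[of 1 0 0] by simp
  then have "lam (comb p 0 0) (comb 0 0 1) = lam (comb 0 e 0) (comb 0 0 1)" by simp
  then have 1: "[chi p c u v p 0 = v ^ e] (mod q)"
    by (simp only: lam_comb comb_0_eq_iff) (simp add: chi_def numeral_2_eq_2)
  obtain n where "p choose 2 = p * n" using p_dvd_choose by blast
  then have "chi p c u v p 0 = u ^ p * v ^ (p * ((p - 1) * c * n))"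
    by (simp add: chi_def mult_ac)
  moreover have "[u ^ p * v ^ (p * ((p - 1) * c * n)) = u ^ p * 1] (mod q)"
    by (rule cong_mult [OF cong_refl v_pow_p_mult])
  ultimately have "[chi p c u v p 0 = u ^ p] (mod q)" by (simp only: mult_1_right)
  from cong_trans [OF cong_sym [OF this] 1] show ?thesis .
qed

text \<open>\<open>a \<otimes> x\<close> is \<open>lam a x\<close> minus \<open>x\<close>, with
  \<open>q - 1\<close> standing for minus one on z. The product depends only on the parameters, so
  equal parameters will give isomorphic braces, and the formula dictates the model built
  later.\<close>

lemma mult_comb:
  "comb a b d \<otimes> comb i j k = comb 0 (c * a * i) ((chi p c u v a b + (q - 1)) * k)"
proof -
  have "comb a b d \<otimes> comb i j k \<oplus> comb i j k = lam (comb a b d) (comb i j k)"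
    by (simp add: lam_def)
  also have "\<dots> = comb 0 (c * a * i) ((chi p c u v a b + (q - 1)) * k) \<oplus> comb i j k"
  proof -
    have "(chi p c u v a b + (q - 1)) * k + k = chi p c u v a b * k + q * k"
      using q_pos by (cases q) (auto simp: algebra_simps)
    then show ?thesis
      by (simp add: lam_comb comb_add comb_same_iff add.commute) (simp add: cong_def)
  qed
  finally show ?thesis
    by (simp add: brace_mult_closed)
qed

end

section \<open>Base change, and comparison of two adapted bases of one brace\<close>

context adapted_brace
begin

lemma comb_cong:
  assumes "[i = i'] (mod p * p)"
  shows "comb i j k = comb i' j k"
proof -
  have *: "comb (i + p * p * t) j k = comb i j k" for i t
  proof -
    have "comb (i + p * p * t) j k = comb i 0 0 \<oplus> comb (p * (p * t)) j k"
      by (simp add: comb_add mult.assoc)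
    also have "comb (p * (p * t)) j k = comb 0 j k"
      by (simp only: comb_p comb_0_eq_iff) (simp add: cong_def mult.left_commute [of e p])
    finally show ?thesis by (simp add: comb_add)
  qed
  obtain s t where "i + s * (p * p) = i' + t * (p * p)"
    using assms by (metis cong_iff_lin_nat)
  then have "comb (i + p * p * s) j k = comb (i' + p * p * t) j k"
    by (simp add: mult.commute)
  then show ?thesis by (simp only: *)
qed

lemma p_torsion:
  assumes "[(p * p)] \<cdot> comb i j k = \<zero>"
  shows "comb i j k = comb i j 0"
proof -
  have "comb 0 (p * p * j + e * (p * i)) (p * p * k) = comb 0 0 0"
    using assms comb_p [of "p * i" "p * p * j" "p * p * k"]
    by (simp add: comb_nat_pow comb_0 mult.assoc)
  then have "q dvd p * p * k"
    by (simp add: comb_0_eq_iff cong_0_iff)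
  moreover have "\<not> q dvd p"
    using p_pos p_less_q nat_dvd_not_less by blast
  ultimately have "q dvd k"
    using prime_q by (simp add: prime_dvd_mult_iff)
  then show ?thesis by (simp add: comb_same_iff cong_0_iff)
qed

lemma q_torsion:
  assumes "[q] \<cdot> comb i j k = \<zero>"
  shows "comb i j k = comb 0 0 k"
proof -
  have np: "\<not> p dvd q"
    using primes_dvd_imp_eq [OF prime_p prime_q] p_less_q by blast
  have eq: "comb (q * i) (q * j) (q * k) = comb 0 0 0"
    using assms by (simp add: comb_nat_pow comb_0)
  then have "p dvd q * i"
    by (simp add: comb_eq_iff reduce_def mod_eq_0_iff_dvd)
  then obtain t where t: "i = p * t"
    using np prime_p by (auto simp: prime_dvd_mult_iff)
  have "comb 0 (q * j + e * (q * t)) (q * k) = comb 0 0 0"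
    using eq comb_p [of "q * t" "q * j" "q * k"] by (simp add: t mult.left_commute)
  then have "p dvd q * j + e * (q * t)"
    by (simp add: comb_0_eq_iff cong_0_iff)
  moreover have "q * j + e * (q * t) = q * (j + e * t)" by (simp add: algebra_simps)
  ultimately have "p dvd j + e * t"
    using np prime_p by (auto simp: prime_dvd_mult_iff)
  then show ?thesis by (simp add: t comb_p comb_0_eq_iff cong_0_iff)
qed

lemma h_nonzero: "h \<noteq> \<zero>" and z_nonzero: "z \<noteq> \<zero>"
proof -
  have "1 < p" "1 < q" using prime_p prime_q prime_gt_1_nat by auto
  then have "comb 0 1 0 \<noteq> comb 0 0 0" "comb 0 0 1 \<noteq> comb 0 0 0"
    by (simp_all add: comb_0_eq_iff cong_0_iff)
  then show "h \<noteq> \<zero>" "z \<noteq> \<zero>"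
    using comb_h comb_z comb_0 by simp_all
qed

text \<open>p copies of the new g are \<open>e * k\<close> copies of h, and the new g moves itself
  by \<open>c * k * k\<close> copies of h; both are re-expressed in the new h, which is
  \<open>l\<close> copies of the old. z stays, since scaling it changes none of the
  constants.\<close>

lemma change_basis:
  assumes k: "coprime k p" and l: "coprime l p"
    and ekl: "[e * k = e' * l] (mod p)" and ckl: "[c * k * k = c' * l] (mod p)"
    and u': "[u' = chi p c u v k m] (mod q)" and v': "[v' = v ^ l] (mod q)"
  shows "adapted_brace A p q e' c' u' v' (comb k m 0) (comb 0 l 0) z"
proof (intro adapted_brace.intro adapted_brace_axioms.intro)
  show "left_brace A" by (rule left_brace_axioms)
  show "[p] \<cdot> comb k m 0 = [e'] \<cdot> comb 0 l 0"
    using ekl by (simp add: comb_nat_pow comb_p comb_0_eq_iff) (simp add: cong_def)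
  show "[p] \<cdot> comb 0 l 0 = \<zero>"
    by (simp add: comb_nat_pow comb_0 [symmetric] comb_0_eq_iff cong_0_iff del: comb_0)
  show "lam (comb k m 0) (comb k m 0) = comb k m 0 \<oplus> [c'] \<cdot> comb 0 l 0"
    using ckl by (simp add: comb_nat_pow lam_comb comb_add comb_same_iff cong_add_lcancel_nat mult.assoc)
  show "lam (comb k m 0) (comb 0 l 0) = comb 0 l 0" "lam (comb 0 l 0) (comb k m 0) = comb k m 0"
    "lam (comb 0 l 0) (comb 0 l 0) = comb 0 l 0"
    by (simp_all add: lam_comb)
  have "lam z (comb i j k) = comb i j k" for i j k
    by (rule lam_z_comb)
  then show "lam z (comb k m 0) = comb k m 0" "lam z (comb 0 l 0) = comb 0 l 0" by blast+
  have "lam (comb k m 0) (comb 0 0 1) = [u'] \<cdot> (comb 0 0 1)"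
    using cong_sym [OF u'] by (simp add: comb_nat_pow lam_comb comb_0_eq_iff)
  then show "lam (comb k m 0) z = [u'] \<cdot> z" by (simp only: comb_z [symmetric])
  have "lam (comb 0 l 0) (comb 0 0 1) = [v'] \<cdot> (comb 0 0 1)"
    using cong_sym [OF v'] by (simp add: comb_nat_pow lam_hpow_comb comb_0_eq_iff)
  then show "lam (comb 0 l 0) z = [v'] \<cdot> z" by (simp only: comb_z [symmetric])
next
  fix x assume "x \<in> carrier A"
  then obtain i j d where x: "x = comb i j d" by (rule comb_exhaust)
  \<comment> \<open>The inverse of \<open>k\<close> is taken modulo \<open>p * p\<close>, as g may
    have order p^2 and its coefficient must be recovered exactly.\<close>
  have "coprime k (p * p)" using k by simp
  then obtain a where "[k * a = 1] (mod p * p)" using cong_solve_coprime_nat [of k "p * p"] by auto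
  then have "[k * a * i = 1 * i] (mod p * p)" by (rule cong_mult [OF _ cong_refl])
  then have a: "[a * i * k = i] (mod p * p)" by (simp add: mult_ac)
  obtain b where b: "[l * b = 1] (mod p)" using l cong_solve_coprime_nat [of l p] by auto
  \<comment> \<open>\<open>?b\<close> corrects the h-coordinate for the contribution
    \<open>a * i * m\<close> of the first summand, with \<open>p - 1\<close> as minus one.\<close>
  let ?b = "b * (j + (p - 1) * (a * i * m))"
  have "[l * b * (j + (p - 1) * (a * i * m)) = 1 * (j + (p - 1) * (a * i * m))] (mod p)"
    using b by (rule cong_mult [OF _ cong_refl])
  then have "[a * i * m + ?b * l = a * i * m + (j + (p - 1) * (a * i * m))] (mod p)"
    by (simp add: mult_ac cong_add_lcancel_nat)
  also have "a * i * m + (j + (p - 1) * (a * i * m)) = j + p * (a * i * m)"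
    using p_pos by (cases p) simp_all
  also have "[\<dots> = j] (mod p)" by (simp add: cong_def)
  finally have b': "[a * i * m + ?b * l = j] (mod p)" .
  have "[(a * i)] \<cdot> comb k m 0 \<oplus> [?b] \<cdot> comb 0 l 0 \<oplus> [d] \<cdot> comb 0 0 1 =
      comb (a * i * k) (a * i * m + ?b * l) d"
    by (simp add: comb_nat_pow comb_add)
  also have "\<dots> = comb i (a * i * m + ?b * l) d" by (rule comb_cong [OF a])
  also have "\<dots> = x" using b' by (simp add: x comb_same_iff)
  finally have "x = [(a * i)] \<cdot> comb k m 0 \<oplus> [?b] \<cdot> comb 0 l 0 \<oplus> [d] \<cdot> comb 0 0 1" ..
  then have "x = [(a * i)] \<cdot> comb k m 0 \<oplus> [?b] \<cdot> comb 0 l 0 \<oplus> [d] \<cdot> z"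
    by (simp only: comb_z [symmetric])
  then show "\<exists>(i::nat) (j::nat) (d::nat). x = [i] \<cdot> comb k m 0 \<oplus> [j] \<cdot> comb 0 l 0 \<oplus> [d] \<cdot> z"
    by blast
qed (use prime_p prime_q p_gt_2 p_less_q card_carrier qz lam_zz in auto)

text \<open>For e = c = 0 neither the additive relations nor the action on the p-part tells g from
  h; only the scalars trade places.\<close>

lemma swap_basis:
  assumes "e = 0" "c = 0"
  shows "adapted_brace A p q 0 0 v u h g z"
proof (intro adapted_brace.intro adapted_brace_axioms.intro)
  show "left_brace A" by (rule left_brace_axioms)
  fix x assume "x \<in> carrier A"
  then obtain i j k where "x = comb i j k" by (rule comb_exhaust)
  then have "x = [j] \<cdot> h \<oplus> [i] \<cdot> g \<oplus> [k] \<cdot> z" by (simp add: comb_def a_comm)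
  then show "\<exists>(i::nat) (j::nat) (k::nat). x = [i] \<cdot> h \<oplus> [j] \<cdot> g \<oplus> [k] \<cdot> z" by blast
qed (use assms prime_p prime_q p_gt_2 p_less_q card_carrier pg ph qz lam_gg lam_gh lam_gz lam_hg
    lam_hh lam_hz lam_zg lam_zh lam_zz in auto)

text \<open>Element orders confine g' and h' to the p-part and z' to the q-part. As the p-part acts
  on the q-part by scalars, u' and v' are values of \<open>chi\<close> whatever the choice of
  z'.\<close>

lemma second_basis:
  assumes "adapted_brace A p q e' c' u' v' g' h' z'"
  obtains k m i j n where "g' = comb k m 0" "h' = comb i j 0" "z' = comb 0 0 n" "coprime n q"
    "[u' = chi p c u v k m] (mod q)" "[v' = chi p c u v i j] (mod q)"
proof -
  interpret B: adapted_brace A p q e' c' u' v' g' h' z' by fact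
  have "[(p * p)] \<cdot> g' = \<zero>"
    using B.pg B.ph add.nat_pow_pow [of g' p p] add.nat_pow_pow [of h' p e'] add.nat_pow_pow [of h' e' p]
    by (simp add: mult.commute)
  moreover obtain k m d where "g' = comb k m d" by (rule comb_exhaust [OF B.g_closed])
  ultimately have g': "g' = comb k m 0" using p_torsion by metis
  have "[(p * p)] \<cdot> h' = \<zero>"
    using B.ph add.nat_pow_pow [of h' p p] by simp
  moreover obtain i j d where "h' = comb i j d" by (rule comb_exhaust [OF B.h_closed])
  ultimately have h': "h' = comb i j 0" using p_torsion by metis
  obtain a b n where "z' = comb a b n" by (rule comb_exhaust [OF B.z_closed])
  then have z': "z' = comb 0 0 n" using q_torsion B.qz by metis
  have "\<not> q dvd n"
    using B.z_nonzero comb_0_eq_iff [of 0 n 0 0] by (simp add: z' comb_0 cong_0_iff)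
  then have n: "coprime n q"
    using prime_q by (metis coprime_commute prime_imp_coprime_nat)
  have "lam (comb k m 0) (comb 0 0 n) = [u'] \<cdot> comb 0 0 n"
    using B.lam_gz by (simp only: g' z')
  then have "[chi p c u v k m * n = u' * n] (mod q)"
    by (simp only: lam_comb comb_nat_pow) (simp add: comb_0_eq_iff)
  then have u': "[u' = chi p c u v k m] (mod q)"
    using n by (simp add: cong_mult_rcancel_nat cong_sym)
  have "lam (comb i j 0) (comb 0 0 n) = [v'] \<cdot> comb 0 0 n"
    using B.lam_hz by (simp only: h' z')
  then have "[chi p c u v i j * n = v' * n] (mod q)"
    by (simp only: lam_comb comb_nat_pow) (simp add: comb_0_eq_iff)
  then have v': "[v' = chi p c u v i j] (mod q)"
    using n by (simp add: cong_mult_rcancel_nat cong_sym)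
  show thesis by (rule that) fact+
qed

text \<open>The rigidity for c' = 1: h' is \<lambda> of g' at g' minus g', hence
  \<open>c * k * k\<close> copies of h. As h' is nonzero, p cannot divide \<open>k\<close>.\<close>

lemma second_basis_1:
  assumes "adapted_brace A p q e' 1 u' v' g' h' z'"
  obtains k m where "\<not> p dvd k" "[u' = chi p c u v k m] (mod q)" "[v' = v ^ (c * k * k)] (mod q)"
    "[e * k = e' * (c * k * k)] (mod p)"
proof -
  interpret B: adapted_brace A p q e' 1 u' v' g' h' z' by fact
  obtain k m i j n where g': "g' = comb k m 0" and z': "z' = comb 0 0 n" and n: "coprime n q"
    and u': "[u' = chi p c u v k m] (mod q)"
    using second_basis [OF assms] by metis
  have "comb k m 0 \<oplus> h' = comb k m 0 \<oplus> comb 0 (c * k * k) 0"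
    using B.lam_gg by (simp add: g' lam_comb comb_add)
  then have h': "h' = comb 0 (c * k * k) 0"
    using add.right_cancel [of "comb k m 0" h' "comb 0 (c * k * k) 0"] by (simp add: a_comm)
  have "\<not> p dvd c * k * k"
    using B.h_nonzero comb_0_eq_iff [of "c * k * k" 0 0 0] by (simp add: h' comb_0 cong_0_iff)
  then have "\<not> p dvd k" by auto
  moreover have "lam (comb 0 (c * k * k) 0) (comb 0 0 n) = [v'] \<cdot> comb 0 0 n"
    using B.lam_hz by (simp only: h' z')
  then have "[v ^ (c * k * k) * n = v' * n] (mod q)"
    by (simp only: lam_hpow_comb comb_nat_pow) (simp add: comb_0_eq_iff)
  then have "[v' = v ^ (c * k * k)] (mod q)"
    using n by (simp add: cong_mult_rcancel_nat cong_sym)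
  moreover have "comb 0 (p * m + e * k) 0 = comb 0 (e' * (c * k * k)) 0"
    using B.pg by (simp only: g' h' comb_nat_pow comb_p mult_0_right)
  then have "[e * k = e' * (c * k * k)] (mod p)"
    by (simp add: comb_0_eq_iff) (simp add: cong_def)
  ultimately show thesis using that u' by blast
qed

text \<open>e = 0 makes the Sylow p-subgroup elementary abelian, a property free of bases.\<close>

lemma second_basis_e:
  assumes "adapted_brace A p q e' c' u' v' g' h' z'" "e = 0"
  shows "p dvd e'"
proof -
  interpret B: adapted_brace A p q e' c' u' v' g' h' z' by fact
  obtain k m where g': "g' = comb k m 0"
    using second_basis [OF assms(1)] by metis
  have "B.comb 0 e' 0 = B.comb (p * 1) 0 0" by (simp only: B.comb_p) simp
  also have "\<dots> = [p] \<cdot> g'" by (simp add: B.comb_def)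
  also have "\<dots> = comb 0 0 0"
    using assms(2) by (simp only: g' comb_nat_pow comb_p mult_0_right comb_0_eq_iff) (simp add: cong_def)
  also have "\<dots> = B.comb 0 0 0" by (simp add: comb_0 B.comb_0)
  finally show ?thesis by (simp add: B.comb_0_eq_iff cong_0_iff)
qed

text \<open>c = 0 means that the Sylow p-subgroup acts trivially on itself, a property free of
  bases.\<close>

lemma second_basis_c:
  assumes "adapted_brace A p q e' c' u' v' g' h' z'" "c = 0"
  shows "p dvd c'"
proof -
  interpret B: adapted_brace A p q e' c' u' v' g' h' z' by fact
  obtain k m where g': "g' = comb k m 0"
    using second_basis [OF assms(1)] by metis
  have "g' \<oplus> [c'] \<cdot> h' = g'"
    using assms(2) B.lam_gg by (simp add: g' lam_comb)
  then have "[c'] \<cdot> h' = \<zero>" by simp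
  then have "B.comb 0 c' 0 = B.comb 0 0 0" by (simp add: B.comb_def)
  then show ?thesis by (simp add: B.comb_0_eq_iff cong_0_iff)
qed

end

section \<open>Isomorphisms and adapted bases\<close>

lemma brace_iso_nat_pow:
  assumes "left_brace A" "left_brace B" "f \<in> brace_iso A B" "x \<in> carrier A"
  shows "f ([(n::nat)] \<cdot>\<^bsub>A\<^esub> x) = [n] \<cdot>\<^bsub>B\<^esub> f x"
proof -
  interpret A: left_brace A by fact
  interpret B: left_brace B by fact
  have fx: "f y \<in> carrier B" if "y \<in> carrier A" for y
    using assms(3) that by (auto simp: brace_iso_def dest: bij_betwE)
  have add: "f (y \<oplus>\<^bsub>A\<^esub> z) = f y \<oplus>\<^bsub>B\<^esub> f z" if "y \<in> carrier A" "z \<in> carrier A" for y z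
    using assms(3) that by (auto simp: brace_iso_def)
  have "f \<zero>\<^bsub>A\<^esub> = \<zero>\<^bsub>B\<^esub>"
    using add [of "\<zero>\<^bsub>A\<^esub>" "\<zero>\<^bsub>A\<^esub>"] fx [of "\<zero>\<^bsub>A\<^esub>"] by simp
  then show ?thesis
    using assms(4) by (induction n) (simp_all add: add)
qed

lemma adapted_brace_iso:
  assumes "adapted_brace A p q e c u v g h z" "left_brace B" "f \<in> brace_iso A B"
  shows "adapted_brace B p q e c u v (f g) (f h) (f z)"
proof -
  interpret A: adapted_brace A p q e c u v g h z by fact
  interpret B: left_brace B by fact
  have bij: "bij_betw f (carrier A) (carrier B)"
    using assms(3) by (simp add: brace_iso_def)
  have fx: "f y \<in> carrier B" if "y \<in> carrier A" for y
    using bij that by (auto dest: bij_betwE)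
  have add: "f (y \<oplus>\<^bsub>A\<^esub> z) = f y \<oplus>\<^bsub>B\<^esub> f z" if "y \<in> carrier A" "z \<in> carrier A" for y z
    using assms(3) that by (auto simp: brace_iso_def)
  have pow: "[(n::nat)] \<cdot>\<^bsub>B\<^esub> f x = f ([n] \<cdot>\<^bsub>A\<^esub> x)" if "x \<in> carrier A" for n x
    using brace_iso_nat_pow [OF A.left_brace_axioms assms(2,3) that] by simp
  have zero: "f \<zero>\<^bsub>A\<^esub> = \<zero>\<^bsub>B\<^esub>"
    using add [of "\<zero>\<^bsub>A\<^esub>" "\<zero>\<^bsub>A\<^esub>"] fx [of "\<zero>\<^bsub>A\<^esub>"] by simp
  have lam: "B.lam (f x) (f y) = f (A.lam x y)" if "x \<in> carrier A" "y \<in> carrier A" for x y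
    using assms(3) that by (auto simp: brace_iso_def A.lam_def B.lam_def A.brace_mult_closed)
  show ?thesis
  proof (intro adapted_brace.intro adapted_brace_axioms.intro)
    show "card (carrier B) = p\<^sup>2 * q"
      using bij A.card_carrier bij_betw_same_card by metis
    fix x assume "x \<in> carrier B"
    then obtain y where y: "y \<in> carrier A" "x = f y"
      using bij by (auto simp: bij_betw_def)
    then obtain i j k where "y = A.comb i j k" using A.comb_exhaust by blast
    then have "x = [i] \<cdot>\<^bsub>B\<^esub> f g \<oplus>\<^bsub>B\<^esub> [j] \<cdot>\<^bsub>B\<^esub> f h \<oplus>\<^bsub>B\<^esub> [k] \<cdot>\<^bsub>B\<^esub> f z"
      using y by (simp add: pow add A.comb_def)
    then show "\<exists>(i::nat) (j::nat) (k::nat). x = [i] \<cdot>\<^bsub>B\<^esub> f g \<oplus>\<^bsub>B\<^esub> [j] \<cdot>\<^bsub>B\<^esub> f h \<oplus>\<^bsub>B\<^esub> [k] \<cdot>\<^bsub>B\<^esub> f z"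
      by blast
  qed (simp_all add: fx pow lam assms(2) zero A.prime_p A.prime_q A.p_gt_2 A.p_less_q A.pg A.ph A.qz
    A.lam_gg A.lam_gh A.lam_gz A.lam_hg A.lam_hh A.lam_hz A.lam_zg A.lam_zh A.lam_zz add)
qed

text \<open>Reduction, sum and product have the same formulas in both coordinate systems, so
  matching coordinates is well defined and preserves both operations.\<close>

lemma adapted_brace_isomorphic:
  assumes "adapted_brace A p q e c u v g h z" "adapted_brace B p q e c u v g' h' z'"
  shows "brace_iso A B \<noteq> {}"
proof -
  interpret A: adapted_brace A p q e c u v g h z by fact
  interpret B: adapted_brace B p q e c u v g' h' z' by fact
  let ?R = "{..<p} \<times> {..<p} \<times> {..<q}"
  let ?a = "\<lambda>(i, j, k). A.comb i j k" and ?b = "\<lambda>(i, j, k). B.comb i j k"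
  define f where "f = ?b \<circ> inv_into ?R ?a"
  have f: "f (A.comb i j k) = B.comb i j k" for i j k
  proof -
    let ?r = "reduce e p q (i, j, k)"
    have "f (A.comb i j k) = ?b (inv_into ?R ?a (?a ?r))"
      by (subst A.comb_reduce) (simp add: f_def)
    also have "inv_into ?R ?a (?a ?r) = ?r"
      by (rule inv_into_f_f [OF A.comb_inj A.reduce_in])
    also have "?b ?r = B.comb i j k" by (rule B.comb_reduce [symmetric])
    finally show ?thesis .
  qed
  have "bij_betw ?a ?R (carrier A)" "bij_betw ?b ?R (carrier B)"
    using A.comb_inj A.comb_surj B.comb_inj B.comb_surj by (auto simp: bij_betw_def)
  then have "bij_betw f (carrier A) (carrier B)"
    unfolding f_def by (rule bij_betw_trans [OF bij_betw_inv_into])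
  moreover have "f (x \<oplus>\<^bsub>A\<^esub> y) = f x \<oplus>\<^bsub>B\<^esub> f y \<and> f (x \<otimes>\<^bsub>A\<^esub> y) = f x \<otimes>\<^bsub>B\<^esub> f y"
    if "x \<in> carrier A" "y \<in> carrier A" for x y
  proof -
    obtain a b d where x: "x = A.comb a b d" by (rule A.comb_exhaust [OF \<open>x \<in> carrier A\<close>])
    obtain i j k where y: "y = A.comb i j k" by (rule A.comb_exhaust [OF \<open>y \<in> carrier A\<close>])
    show ?thesis
      unfolding x y f A.comb_add B.comb_add A.mult_comb B.mult_comb by blast
  qed
  ultimately have "f \<in> brace_iso A B" by (simp add: brace_iso_def)
  then show ?thesis by blast
qed

section \<open>Existence of adapted bases\<close>

lemma (in abelian_group) nat_pow_eq_iff_prime: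
  assumes "x \<in> carrier G" "prime r" "[r] \<cdot> x = \<zero>" "x \<noteq> \<zero>"
  shows "[(i::nat)] \<cdot> x = [(j::nat)] \<cdot> x \<longleftrightarrow> [i = j] (mod r)"
proof -
  have "add.ord x dvd r" using assms add.pow_eq_id by blast
  moreover have "add.ord x \<noteq> 1" using assms add.ord_eq_1 by blast
  ultimately have ord: "add.ord x = r" using assms(2) prime_nat_iff by blast
  have le: "[(i::nat)] \<cdot> x = [(j::nat)] \<cdot> x \<longleftrightarrow> [i = j] (mod r)" if "i \<le> j" for i j
  proof -
    have "[j] \<cdot> x = [(j - i)] \<cdot> x \<oplus> [i] \<cdot> x"
      using that assms(1) by (simp add: add.nat_pow_mult)
    then have "[i] \<cdot> x = [j] \<cdot> x \<longleftrightarrow> [(j - i)] \<cdot> x = \<zero>"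
      using assms(1) by simp
    then show ?thesis
      using assms(1) ord that add.pow_eq_id [of x "j - i"] by (metis cong_altdef_nat cong_sym_eq)
  qed
  show ?thesis using le [of i j] le [of j i] by (metis cong_sym_eq nat_le_linear)
qed

context left_brace
begin

definition torsion :: "nat \<Rightarrow> 'a set"
  where "torsion n = {x \<in> carrier A. [n] \<cdot> x = \<zero>}"

lemma left_ideal_torsion: "left_ideal (torsion n)"
  unfolding left_ideal_def
proof
  show "subgroup (torsion n) (add_monoid A)"
    by (rule add.subgroupI)
      (auto simp: torsion_def add.nat_pow_inv add.nat_pow_distrib intro!: exI [of _ \<zero>])
  show "\<forall>a\<in>carrier A. \<forall>x\<in>torsion n. lam a x \<in> torsion n"
    by (auto simp: torsion_def lam_nat_pow [symmetric])
qed

lemma torsion_add: "x \<in> torsion n \<Longrightarrow> y \<in> torsion n \<Longrightarrow> x \<oplus> y \<in> torsion n"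
  by (auto simp: torsion_def add.nat_pow_distrib)

lemma torsion_pow: "x \<in> torsion n \<Longrightarrow> [(k::nat)] \<cdot> x \<in> torsion n"
  by (auto simp: torsion_def add.nat_pow_pow) (metis add.nat_pow_one add.nat_pow_pow mult.commute)

lemma torsion_zero: "\<zero> \<in> torsion n"
  by (simp add: torsion_def)

lemma card_torsion_ge:
  assumes "finite (carrier A)" "prime p" "card (carrier A) = p ^ a * m"
  shows "p ^ a \<le> card (torsion (p ^ a))"
proof -
  obtain H where H: "subgroup H (add_monoid A)" "card H = p ^ a"
    using sylow_thm [OF assms(2) add.is_group, of a m] assms(1,3) by (auto simp: order_def)
  interpret H: group "add_monoid A\<lparr>carrier := H\<rparr>"
    using H(1) by (rule add.subgroup_imp_group)
  have "H \<subseteq> torsion (p ^ a)"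
  proof
    fix x assume x: "x \<in> H"
    then have "x \<in> carrier A" using subgroup.subset [OF H(1)] by auto
    moreover have "[(p ^ a)] \<cdot> x = \<zero>"
      using H.pow_order_eq_1 [of x] x H(2)
      by (simp add: order_def add.nat_pow_consistent [of _ _ H])
    ultimately show "x \<in> torsion (p ^ a)" by (simp add: torsion_def)
  qed
  moreover have "finite (torsion (p ^ a))"
    using assms(1) by (simp add: torsion_def)
  ultimately have "card H \<le> card (torsion (p ^ a))" by (rule card_mono [rotated])
  then show ?thesis using H(2) by simp
qed

end

section \<open>The Sylow subgroups of a brace of order p^2 q\<close>

locale brace_p2q = left_brace +
  fixes p q :: nat
  assumes prime_p: "prime p" and prime_q: "prime q" and p_gt_2: "2 < p" and p_less_q: "p < q"
    and finite_carrier: "finite (carrier A)" and card_carrier: "card (carrier A) = p\<^sup>2 * q"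
begin

abbreviation "P \<equiv> torsion (p\<^sup>2)"
abbreviation "Q \<equiv> torsion q"

lemma P_carrier: "x \<in> P \<Longrightarrow> x \<in> carrier A" and Q_carrier: "x \<in> Q \<Longrightarrow> x \<in> carrier A"
  by (simp_all add: torsion_def)

lemma finite_torsion: "finite (torsion n)"
  using finite_carrier by (simp add: torsion_def)

lemma P_lam: "a \<in> carrier A \<Longrightarrow> x \<in> P \<Longrightarrow> lam a x \<in> P"
  and Q_lam: "a \<in> carrier A \<Longrightarrow> x \<in> Q \<Longrightarrow> lam a x \<in> Q"
  using left_ideal_torsion by (auto simp: left_ideal_def)

lemma not_p_dvd_q: "\<not> p dvd q" and not_q_dvd_p: "\<not> q dvd p"
  using primes_dvd_imp_eq [OF prime_p prime_q] primes_dvd_imp_eq [OF prime_q prime_p] p_less_q by auto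

lemma P_Q_zero: "x \<in> P \<Longrightarrow> x \<in> Q \<Longrightarrow> x = \<zero>"
proof -
  assume "x \<in> P" "x \<in> Q"
  then have "x \<in> carrier A" "add.ord x dvd p\<^sup>2" "add.ord x dvd q"
    by (auto simp: torsion_def add.pow_eq_id)
  moreover have "coprime (p\<^sup>2) q"
    using not_p_dvd_q prime_p by (simp add: prime_imp_coprime_nat)
  ultimately have "add.ord x = 1"
    using coprime_common_divisor_nat by blast
  then show ?thesis using add.ord_eq_1 \<open>x \<in> carrier A\<close> by blast
qed

lemma P_Q_inj: "inj_on (\<lambda>(x, y). x \<oplus> y) (P \<times> Q)"
proof (rule inj_onI, clarify)
  fix x y x' y' assume xy: "x \<in> P" "y \<in> Q" "x' \<in> P" "y' \<in> Q" and eq: "x \<oplus> y = x' \<oplus> y'"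
  have neg: "\<ominus> w \<in> torsion n" if "w \<in> torsion n" for w n
    using that by (auto simp: torsion_def add.nat_pow_inv)
  note car = P_carrier [OF xy(1)] Q_carrier [OF xy(2)] P_carrier [OF xy(3)] Q_carrier [OF xy(4)]
  have "x \<oplus> \<ominus> x' = (x \<oplus> y) \<oplus> (\<ominus> y \<oplus> \<ominus> x')"
    using car by (simp add: a_assoc [symmetric]) (simp add: a_assoc r_neg)
  also have "\<dots> = (y' \<oplus> \<ominus> y) \<oplus> (x' \<oplus> \<ominus> x')"
    using car by (simp add: eq) (simp add: a_ac)
  also have "\<dots> = y' \<oplus> \<ominus> y"
    using car by (simp add: r_neg)
  finally have "x \<oplus> \<ominus> x' = y' \<oplus> \<ominus> y" .
  moreover have "x \<oplus> \<ominus> x' \<in> P" "y' \<oplus> \<ominus> y \<in> Q"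
    using xy neg torsion_add by blast+
  ultimately have "x \<oplus> \<ominus> x' = \<zero>" "y' \<oplus> \<ominus> y = \<zero>"
    using P_Q_zero by metis+
  then show "x = x' \<and> y = y'"
    using car by (metis minus_equality minus_minus a_comm a_inv_closed)
qed

text \<open>Sylow gives p^2 \<le> |P| and q \<le> |Q|, and injectivity of addition on pairs gives
  |P| |Q| \<le> p^2 q; so all are equalities and addition is onto.\<close>

lemma card_P: "card P = p\<^sup>2" and card_Q: "card Q = q"
  and P_Q_surj: "(\<lambda>(x, y). x \<oplus> y) ` (P \<times> Q) = carrier A"
proof -
  have P: "p\<^sup>2 \<le> card P"
    using card_torsion_ge [OF finite_carrier prime_p card_carrier] .
  have Q: "q \<le> card Q"
    using card_torsion_ge [OF finite_carrier prime_q, of 1 "p\<^sup>2"] card_carrier by simp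
  have sub: "(\<lambda>(x, y). x \<oplus> y) ` (P \<times> Q) \<subseteq> carrier A"
    using P_carrier Q_carrier by auto
  have le: "card P * card Q \<le> p\<^sup>2 * q"
    using card_inj_on_le [OF P_Q_inj sub finite_carrier]
    by (simp add: card_cartesian_product card_carrier)
  have pos: "0 < p\<^sup>2" "0 < q" using prime_p prime_q prime_gt_0_nat by auto
  show cP: "card P = p\<^sup>2"
  proof (rule ccontr)
    assume "card P \<noteq> p\<^sup>2"
    then have "p\<^sup>2 * q < card P * card Q" using P Q pos by (intro mult_less_le_imp_less) auto
    then show False using le by simp
  qed
  show cQ: "card Q = q"
  proof (rule ccontr)
    assume "card Q \<noteq> q"
    then have "p\<^sup>2 * q < card P * card Q" using P Q pos by (intro mult_le_less_imp_less) auto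
    then show False using le by simp
  qed
  show "(\<lambda>(x, y). x \<oplus> y) ` (P \<times> Q) = carrier A"
    by (rule card_subset_eq [OF finite_carrier sub])
      (simp add: card_image [OF P_Q_inj] card_cartesian_product cP cQ card_carrier)
qed

text \<open>The number of fixed points is a multiple of q, positive because of zero, and at most
  q.\<close>

lemma Q_fixes_Q:
  assumes "x \<in> Q" "y \<in> Q"
  shows "lam x y = y"
proof -
  let ?F = "{y \<in> Q. \<forall>a\<in>Q. lam a y = y}"
  have "[card Q = card ?F] (mod q)"
    by (rule lam_fixed_points [where a = 1])
      (use left_ideal_torsion prime_q card_Q finite_torsion Q_lam Q_carrier in auto)
  then have "q dvd card ?F" by (simp add: card_Q cong_0_iff cong_sym_eq [of 0] cong_def mod_eq_0_iff_dvd)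
  moreover have "\<zero> \<in> ?F" using torsion_zero Q_carrier by auto
  then have "0 < card ?F" using finite_torsion by (auto simp: card_gt_0_iff)
  ultimately have "card Q \<le> card ?F" by (simp add: card_Q dvd_imp_le)
  then have "?F = Q" using finite_torsion by (intro card_seteq) auto
  then show ?thesis using assms by blast
qed

text \<open>The fixed points form a subgroup of P, of order p^k say, and q divides p^2 - p^k; with q
  > p > 2 only k = 2 remains.\<close>

lemma Q_fixes_P:
  assumes "x \<in> Q" "y \<in> P"
  shows "lam x y = y"
proof -
  let ?F = "{y \<in> P. \<forall>a\<in>Q. lam a y = y}"
  have cong: "[card P = card ?F] (mod q)"
    by (rule lam_fixed_points [where a = 1])
      (use left_ideal_torsion prime_q card_Q finite_torsion P_lam P_carrier Q_carrier in auto)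
  have P: "subgroup P (add_monoid A)"
    using left_ideal_torsion by (simp add: left_ideal_def)
  have neg: "lam a (\<ominus> y) = \<ominus> y" if "a \<in> carrier A" "y \<in> carrier A" "lam a y = y" for a y
  proof -
    have "lam a (\<ominus> y) \<oplus> y = \<zero>"
      using lam_add [of a "\<ominus> y" y] that by (simp add: l_neg)
    then show ?thesis using that by (metis a_inv_closed lam_closed minus_equality)
  qed
  have "subgroup ?F (add_monoid A)"
  proof (rule add.subgroupI)
    show "\<ominus> y \<in> ?F" if "y \<in> ?F" for y
      using that neg P_carrier Q_carrier subgroup.m_inv_closed [OF P, of y] by (auto simp: a_inv_def)
    show "?F \<noteq> {}" using torsion_zero [of "p\<^sup>2"] lam_zero [OF Q_carrier] by blast
  qed (use torsion_add P_carrier Q_carrier in \<open>auto simp: lam_add\<close>)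
  then have "subgroup ?F (add_monoid A\<lparr>carrier := P\<rparr>)"
    by (rule add.subgroup_incl [OF _ P]) auto
  then have "card (rcosets\<^bsub>add_monoid A\<lparr>carrier := P\<rparr>\<^esub> ?F) * card ?F = card P"
    using group.lagrange [OF add.subgroup_imp_group [OF P]] by (simp add: order_def)
  then have "card ?F dvd card P" by (rule subst) (rule dvd_triv_right)
  then obtain k where k: "k \<le> 2" "card ?F = p ^ k"
    using prime_p by (auto simp: card_P divides_primepow_nat)
  have dvd: "q dvd p\<^sup>2 - p ^ k"
    using cong k p_gt_2 by (simp add: card_P cong_altdef_nat power_increasing)
  have "k = 2"
  proof (rule ccontr)
    assume "k \<noteq> 2"
    then consider "k = 0" | "k = 1" using k by linarith
    then show False
    proof cases
      case 1
      have "p\<^sup>2 - 1 = (p - 1) * (p + 1)"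
        by (simp add: power2_eq_square algebra_simps)
      then have "q dvd (p - 1) * (p + 1)" using dvd 1 by (simp only: power_0)
      then have "q dvd p - 1 \<or> q dvd p + 1"
        using prime_q prime_dvd_mult_iff by blast
      then have "q \<le> p - 1 \<or> q \<le> p + 1" using p_gt_2 dvd_imp_le by auto
      \<comment> \<open>q exceeds p, so it can only be p + 1, which parity excludes because p is
        odd.\<close>
      then have "q = p + 1" using p_less_q by linarith
      moreover have "odd p" "odd q"
        using prime_p prime_q p_gt_2 p_less_q prime_odd_nat by auto
      ultimately show False by simp
    next
      case 2
      have "p\<^sup>2 - p = p * (p - 1)" by (simp add: power2_eq_square algebra_simps)
      then have "q dvd p - 1"
        using dvd 2 prime_q not_q_dvd_p by (simp add: prime_dvd_mult_iff)
      then have "q \<le> p - 1" using p_gt_2 by (intro dvd_imp_le) simp_all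
      then show False using p_less_q by linarith
    qed
  qed
  then have "?F = P" using k finite_torsion card_P by (intro card_subset_eq) auto
  then show ?thesis using assms by blast
qed

lemma P_Q_decompose:
  assumes "x \<in> carrier A"
  obtains y w where "y \<in> P" "w \<in> Q" "x = y \<oplus> w"
proof -
  from assms have "x \<in> (\<lambda>(x, y). x \<oplus> y) ` (P \<times> Q)" by (simp only: P_Q_surj)
  with that show thesis by auto
qed

lemma Q_fixes:
  assumes "x \<in> Q" "y \<in> carrier A"
  shows "lam x y = y"
  using assms(2)
proof (rule P_Q_decompose)
  fix a b assume "a \<in> P" "b \<in> Q" "y = a \<oplus> b"
  then show ?thesis
    using assms(1) by (simp add: lam_add P_carrier Q_carrier Q_fixes_P Q_fixes_Q)
qed

lemma Q_generator:
  obtains z where "z \<in> Q" "z \<noteq> \<zero>" "\<And>x. x \<in> Q \<Longrightarrow> \<exists>k::nat. x = [k] \<cdot> z"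
proof -
  have q1: "1 < q" using prime_q prime_gt_1_nat by blast
  have "\<not> Q \<subseteq> {\<zero>}"
  proof
    assume "Q \<subseteq> {\<zero>}"
    then have "card Q \<le> card {\<zero>}" by (intro card_mono) auto
    then show False using card_Q q1 by simp
  qed
  then obtain z where z: "z \<in> Q" "z \<noteq> \<zero>" by blast
  have "inj_on (\<lambda>k::nat. [k] \<cdot> z) {..<q}"
    using nat_pow_eq_iff_prime [OF Q_carrier [OF z(1)] prime_q _ z(2)] z(1)
    by (auto simp: inj_on_def torsion_def cong_less_modulus_unique_nat)
  then have "(\<lambda>k::nat. [k] \<cdot> z) ` {..<q} = Q"
    using z(1) torsion_pow finite_torsion card_Q by (intro card_subset_eq) (auto simp: card_image)
  then show thesis using that z by (metis imageE)
qed

text \<open>p divides the number of fixed points and zero is one of them, so there is another; if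
  its order is p^2, its p-th multiple is taken instead.\<close>

lemma P_fixed_element:
  obtains h where "h \<in> P" "h \<noteq> \<zero>" "[p] \<cdot> h = \<zero>" "\<And>a. a \<in> P \<Longrightarrow> lam a h = h"
proof -
  let ?F = "{y \<in> P. \<forall>a\<in>P. lam a y = y}"
  have "[card P = card ?F] (mod p)"
    by (rule lam_fixed_points [where a = 2])
      (use left_ideal_torsion prime_p card_P finite_torsion P_lam P_carrier in auto)
  then have "[0 = card ?F] (mod p)" by (simp add: card_P cong_def)
  from cong_sym [OF this] have "p dvd card ?F" by (simp only: cong_0_iff)
  have "\<not> ?F \<subseteq> {\<zero>}"
  proof
    assume "?F \<subseteq> {\<zero>}"
    moreover have "\<zero> \<in> ?F" using torsion_zero P_carrier by auto
    ultimately have "?F = {\<zero>}" by blast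
    then have "card ?F = 1" by simp
    then show False using \<open>p dvd card ?F\<close> p_gt_2 by simp
  qed
  then obtain f where f: "f \<in> P" "f \<noteq> \<zero>" "\<And>a. a \<in> P \<Longrightarrow> lam a f = f" by blast
  show thesis
  proof (cases "[p] \<cdot> f = \<zero>")
    case True
    then show thesis using that f by blast
  next
    case False
    have "[p] \<cdot> ([p] \<cdot> f) = \<zero>"
      using f(1) by (simp add: torsion_def add.nat_pow_pow power2_eq_square)
    moreover have "lam a ([p] \<cdot> f) = [p] \<cdot> f" if "a \<in> P" for a
      using that f P_carrier by (simp add: lam_nat_pow)
    ultimately show thesis using that [of "[p] \<cdot> f"] False f(1) torsion_pow by blast
  qed
qed

text \<open>Any g outside the subgroup generated by h completes h. Coordinates along g are unique
  only modulo p, because p g may be a nonzero multiple of h.\<close>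

lemma P_generators:
  obtains g h where "g \<in> P" "h \<in> P" "h \<noteq> \<zero>" "[p] \<cdot> h = \<zero>" "\<And>a. a \<in> P \<Longrightarrow> lam a h = h"
    "\<And>x. x \<in> P \<Longrightarrow> \<exists>(i::nat) (j::nat). x = [i] \<cdot> g \<oplus> [j] \<cdot> h"
    "\<And>(i::nat) (j::nat) (i'::nat) (j'::nat).
      [i] \<cdot> g \<oplus> [j] \<cdot> h = [i'] \<cdot> g \<oplus> [j'] \<cdot> h \<Longrightarrow> [i = i'] (mod p)"
    "\<exists>e::nat. [p] \<cdot> g = [e] \<cdot> h"
proof -
  obtain h where h: "h \<in> P" "h \<noteq> \<zero>" "[p] \<cdot> h = \<zero>" "\<And>a. a \<in> P \<Longrightarrow> lam a h = h"
    using P_fixed_element by metis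
  note hc [simp] = P_carrier [OF h(1)]
  have p0: "0 < p" using p_gt_2 by simp
  define H where "H = range (\<lambda>j::nat. [j] \<cdot> h)"
  have h_eq: "[(i::nat)] \<cdot> h = [(j::nat)] \<cdot> h \<longleftrightarrow> [i = j] (mod p)" for i j
    by (rule nat_pow_eq_iff_prime [OF hc prime_p h(3,2)])
  have H_eq: "H = (\<lambda>j::nat. [j] \<cdot> h) ` {..<p}"
  proof -
    have "[(j::nat)] \<cdot> h = [(j mod p)] \<cdot> h" for j by (simp add: h_eq cong_def)
    moreover have "j mod p \<in> {..<p}" for j using p0 by simp
    ultimately show ?thesis unfolding H_def by blast
  qed
  then have "card H \<le> p" using card_image_le [of "{..<p}" "\<lambda>j::nat. [j] \<cdot> h"] by simp
  moreover have "p < p\<^sup>2" using p_gt_2 by (simp add: power2_eq_square)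
  then have "p < card P" by (simp only: card_P)
  ultimately have "\<not> P \<subseteq> H"
    using card_mono [of H P] finite_torsion H_eq by auto
  then obtain g where g: "g \<in> P" "g \<notin> H" by blast
  note gc [simp] = P_carrier [OF g(1)]
  have H_pow: "[(k::nat)] \<cdot> x \<in> H" if "x \<in> H" for k x
    using that by (auto simp: H_def add.nat_pow_pow)
  \<comment> \<open>Otherwise an inverse of \<open>n\<close> modulo p^2 recovers g from n g and puts
    it into \<open>H\<close>.\<close>
  have dvd: "p dvd n" if "[n] \<cdot> g \<in> H" for n
  proof (rule ccontr)
    assume "\<not> p dvd n"
    then have "coprime n (p\<^sup>2)"
      using prime_imp_coprime_nat [OF prime_p] by (simp add: coprime_commute [of n])
    then obtain n' where n': "[n * n' = 1] (mod p\<^sup>2)"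
      using cong_solve_coprime_nat [of n "p\<^sup>2"] by auto
    have "[(n * n')] \<cdot> g = [(1::nat)] \<cdot> g"
    proof -
      obtain s t where "n * n' + s * p\<^sup>2 = 1 + t * p\<^sup>2"
        using n' by (metis cong_iff_lin_nat)
      then have "[(n * n' + p\<^sup>2 * s)] \<cdot> g = [(1 + p\<^sup>2 * t)] \<cdot> g" by (simp add: mult.commute)
      moreover have "[(p\<^sup>2 * s)] \<cdot> g = \<zero>" for s
        using g(1) add.nat_pow_pow [OF gc, of s "p\<^sup>2"] by (simp add: torsion_def)
      ultimately show ?thesis by (simp only: add.nat_pow_mult [symmetric] gc r_zero add.nat_pow_closed)
    qed
    then have "[n'] \<cdot> ([n] \<cdot> g) = g" by (simp add: add.nat_pow_pow)
    then show False using H_pow [OF that] g(2) by metis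
  qed
  have H_diff: "[(j + (p - 1) * j')] \<cdot> h \<oplus> [(j'::nat)] \<cdot> h = [(j::nat)] \<cdot> h" for j j'
  proof -
    have "j + (p - 1) * j' + j' = j + p * j'" using p0 by (cases p) simp_all
    moreover have "[j + p * j' = j] (mod p)" by (simp add: cong_def)
    ultimately show ?thesis by (simp only: add.nat_pow_mult hc h_eq)
  qed
  have le: "[i = i'] (mod p)"
    if eq: "[i] \<cdot> g \<oplus> [j] \<cdot> h = [i'] \<cdot> g \<oplus> [j'] \<cdot> h" and "i \<le> i'" for i j i' j' :: nat
  proof -
    let ?d = "[(j + (p - 1) * j')] \<cdot> h"
    have "[(i' - i)] \<cdot> g \<oplus> ([i] \<cdot> g \<oplus> [j'] \<cdot> h) = [i'] \<cdot> g \<oplus> [j'] \<cdot> h"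
      using \<open>i \<le> i'\<close> by (simp add: a_assoc [symmetric] add.nat_pow_mult)
    also have "\<dots> = ?d \<oplus> ([i] \<cdot> g \<oplus> [j'] \<cdot> h)"
      by (simp add: eq [symmetric] H_diff [of j j', symmetric] a_ac)
    finally have "[(i' - i)] \<cdot> g = ?d"
      by (subst (asm) add.right_cancel) simp_all
    then have "p dvd i' - i" using dvd unfolding H_def by blast
    then show ?thesis using \<open>i \<le> i'\<close> by (simp add: cong_altdef_nat cong_sym_eq)
  qed
  have uniq: "[i = i'] (mod p)"
    if "[i] \<cdot> g \<oplus> [j] \<cdot> h = [i'] \<cdot> g \<oplus> [j'] \<cdot> h" for i j i' j' :: nat
    using le [OF that] le [OF that [symmetric]] by (metis cong_sym_eq nat_le_linear)
  have "inj_on (\<lambda>(i::nat, j::nat). [i] \<cdot> g \<oplus> [j] \<cdot> h) ({..<p} \<times> {..<p})"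
  proof (rule inj_onI, clarify)
    fix i j i' j' assume lt: "i < p" "j < p" "i' < p" "j' < p"
      and eq: "[i] \<cdot> g \<oplus> [j] \<cdot> h = [i'] \<cdot> g \<oplus> [j'] \<cdot> h"
    have i: "i = i'" using uniq [OF eq] lt by (simp add: cong_less_modulus_unique_nat)
    have "[j] \<cdot> h \<oplus> [i] \<cdot> g = [j'] \<cdot> h \<oplus> [i] \<cdot> g" using eq by (simp add: i a_comm)
    then have "[j = j'] (mod p)" by (simp add: h_eq)
    then show "i = i' \<and> j = j'" using i lt by (simp add: cong_less_modulus_unique_nat)
  qed
  then have "(\<lambda>(i::nat, j::nat). [i] \<cdot> g \<oplus> [j] \<cdot> h) ` ({..<p} \<times> {..<p}) = P"
    using finite_torsion card_P torsion_add torsion_pow g(1) h(1)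
    by (intro card_subset_eq) (auto simp: card_image card_cartesian_product power2_eq_square)
  then have gen: "\<exists>(i::nat) (j::nat). i < p \<and> x = [i] \<cdot> g \<oplus> [j] \<cdot> h" if "x \<in> P" for x
    using that by (force simp: image_iff set_eq_iff)
  obtain i j :: nat where i: "i < p" and "[p] \<cdot> g = [i] \<cdot> g \<oplus> [j] \<cdot> h"
    using gen torsion_pow g(1) by blast
  then have pg: "[p] \<cdot> g \<oplus> [(0::nat)] \<cdot> h = [i] \<cdot> g \<oplus> [j] \<cdot> h" by simp
  \<comment> \<open>Uniqueness modulo p, applied to the coordinates of p g, forces the coefficient
    \<open>i < p\<close> to vanish.\<close>
  have "p dvd i" using uniq [OF pg] by (simp add: cong_def mod_eq_0_iff_dvd)
  then have "i = 0" using i by (meson dvd_imp_le not_gr_zero not_le)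
  then have "[p] \<cdot> g = [j] \<cdot> h" using pg by simp
  then have "\<exists>e::nat. [p] \<cdot> g = [e] \<cdot> h" by blast
  moreover have "\<exists>(i::nat) (j::nat). x = [i] \<cdot> g \<oplus> [j] \<cdot> h" if "x \<in> P" for x
    using gen [OF that] by blast
  ultimately show thesis by (intro that [OF g(1) h]) (assumption | rule uniq)+
qed

text \<open>The function \<open>c\<close> with \<open>lam a g = g \<oplus> [c a] \<cdot> h\<close> turns \<open>\<circ>\<close> on \<open>P\<close> into addition modulo \<open>p\<close>.
  Computing \<open>c\<close> on \<open>h \<circ> g\<close> in two ways gives \<open>c h \<cdot> c h = 0\<close>, hence \<open>c h = 0\<close>.\<close>

theorem adapted_basis_exists:
  obtains e c u v g h z where "adapted_brace A p q e c u v g h z"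
proof -
  obtain g h where g: "g \<in> P" and h: "h \<in> P" "h \<noteq> \<zero>" "[p] \<cdot> h = \<zero>" "\<And>a. a \<in> P \<Longrightarrow> lam a h = h"
    and gen: "\<And>x. x \<in> P \<Longrightarrow> \<exists>(i::nat) (j::nat). x = [i] \<cdot> g \<oplus> [j] \<cdot> h"
    and uniq: "\<And>(i::nat) (j::nat) (i'::nat) (j'::nat).
      [i] \<cdot> g \<oplus> [j] \<cdot> h = [i'] \<cdot> g \<oplus> [j'] \<cdot> h \<Longrightarrow> [i = i'] (mod p)"
    and "\<exists>e::nat. [p] \<cdot> g = [e] \<cdot> h"
    using P_generators by metis
  then obtain e :: nat where e: "[p] \<cdot> g = [e] \<cdot> h" by blast
  obtain z where z: "z \<in> Q" "z \<noteq> \<zero>" and genz: "\<And>x. x \<in> Q \<Longrightarrow> \<exists>k::nat. x = [k] \<cdot> z"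
    using Q_generator by metis
  note [simp] = P_carrier [OF g] P_carrier [OF h(1)] Q_carrier [OF z(1)]
  have h_eq: "[(i::nat)] \<cdot> h = [(j::nat)] \<cdot> h \<longleftrightarrow> [i = j] (mod p)" for i j
    by (rule nat_pow_eq_iff_prime [OF _ prime_p h(3,2)]) simp
  \<comment> \<open>\<lambda> of \<open>a\<close> is triangular with respect to g and h, with
    diagonal entry \<open>m\<close>. Its p^2-th iterate is the identity, so m^(p^2) = 1 modulo p,
    and Fermat gives m = 1 modulo p.\<close>
  have unipotent: "\<exists>d::nat. lam a g = g \<oplus> [d] \<cdot> h" if a: "a \<in> P" for a
  proof -
    note ac [simp] = P_carrier [OF a]
    obtain m d :: nat where md: "lam a g = [m] \<cdot> g \<oplus> [d] \<cdot> h"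
      using gen P_lam [OF ac g] by blast
    have "\<exists>d::nat. (lam a ^^ n) g = [(m ^ n)] \<cdot> g \<oplus> [d] \<cdot> h" for n
    proof (induction n)
      case 0
      have "(lam a ^^ 0) g = [(m ^ 0)] \<cdot> g \<oplus> [(0::nat)] \<cdot> h" by simp
      then show ?case by blast
    next
      case (Suc n)
      then obtain d' :: nat where "(lam a ^^ n) g = [(m ^ n)] \<cdot> g \<oplus> [d'] \<cdot> h" by blast
      then have "(lam a ^^ Suc n) g = [(m ^ n)] \<cdot> ([m] \<cdot> g \<oplus> [d] \<cdot> h) \<oplus> [d'] \<cdot> h"
        using h(4) [OF a] by (simp add: lam_add lam_nat_pow md)
      also have "\<dots> = [(m ^ Suc n)] \<cdot> g \<oplus> [(d * m ^ n + d')] \<cdot> h"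
        by (simp add: add.nat_pow_distrib add.nat_pow_pow a_assoc add.nat_pow_mult)
      finally show ?case by blast
    qed
    then obtain d' :: nat where "(lam a ^^ p\<^sup>2) g = [(m ^ p\<^sup>2)] \<cdot> g \<oplus> [d'] \<cdot> h" by blast
    moreover have "(lam a ^^ p\<^sup>2) g = g"
      using lam_funpow_card [OF left_ideal_torsion finite_torsion a] by (simp add: card_P)
    ultimately have "[(m ^ p\<^sup>2)] \<cdot> g \<oplus> [d'] \<cdot> h = [(1::nat)] \<cdot> g \<oplus> [(0::nat)] \<cdot> h" by simp
    then have m1: "[m ^ p\<^sup>2 = 1] (mod p)" by (rule uniq)
    have fermat: "[x ^ p = x] (mod p)" for x
    proof (cases "p dvd x")
      case True
      moreover have "x dvd x ^ p" using p_gt_2 by (intro dvd_power) simp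
      ultimately have "p dvd x ^ p" by (rule dvd_trans)
      then show ?thesis using True by (simp add: cong_def mod_eq_0_iff_dvd)
    next
      case False
      have "[x ^ (p - 1) * x = 1 * x] (mod p)"
        by (rule cong_mult [OF fermat_theorem [OF prime_p False] cong_refl])
      moreover have "x ^ (p - 1) * x = x ^ p" using p_gt_2 by (intro power_minus_mult) simp
      ultimately show ?thesis by (simp only: mult_1_left)
    qed
    have "[m ^ p\<^sup>2 = m] (mod p)"
      using cong_trans [OF cong_pow [OF fermat [of m], of p] fermat [of m]]
      by (simp add: power_mult power2_eq_square)
    then have m: "[m = 1] (mod p)" using m1 by (metis cong_sym cong_trans)
    have "m \<noteq> 0"
    proof
      assume "m = 0"
      then show False using m p_gt_2 by (simp add: cong_def)
    qed
    then obtain t where t: "m = 1 + p * t"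
      using m by (metis One_nat_def Suc_leI cong_le_nat mult.commute add.commute not_gr_zero)
    \<comment> \<open>The excess of m g over g is itself a multiple of h and is absorbed into the
      second coordinate.\<close>
    have "[(p * t)] \<cdot> g = [(e * t)] \<cdot> h"
      using e by (metis \<open>g \<in> carrier A\<close> \<open>h \<in> carrier A\<close> add.nat_pow_pow)
    then have "lam a g = g \<oplus> [(e * t + d)] \<cdot> h"
      by (simp add: md t add.nat_pow_mult [symmetric] a_ac)
    then show ?thesis by blast
  qed
  obtain c d :: nat where c: "lam g g = g \<oplus> [c] \<cdot> h" and d: "lam h g = g \<oplus> [d] \<cdot> h"
    using unipotent g h(1) by metis
  have hh: "lam h h = h" and gh: "lam g h = h" using h(4) h(1) g by blast+
  \<comment> \<open>Elements of P fix h, so adding h is the circle product with h on the right, and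
    each copy contributes \<open>d\<close> once more.\<close>
  have step: "lam (a \<oplus> [(k::nat)] \<cdot> h) g = lam a g \<oplus> [(k * d)] \<cdot> h" if a: "a \<in> P" for a k
  proof (induction k)
    case 0
    then show ?case using P_carrier [OF a] by simp
  next
    case (Suc k)
    let ?a = "a \<oplus> [k] \<cdot> h"
    have a': "?a \<in> P" using a h(1) torsion_add torsion_pow by blast
    have "a \<oplus> [Suc k] \<cdot> h = ?a \<oplus> lam ?a h"
      using h(4) [OF a'] P_carrier [OF a] by (simp add: a_assoc)
    then have "lam (a \<oplus> [Suc k] \<cdot> h) g = lam ?a (lam h g)"
      using lam_circ [OF P_carrier [OF a'], of h g] by simp
    also have "\<dots> = lam ?a g \<oplus> [d] \<cdot> h"
      using h(4) [OF a'] P_carrier [OF a'] by (simp add: d lam_add lam_nat_pow)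
    finally show ?case
      using P_carrier [OF a] by (simp add: Suc a_assoc add.nat_pow_mult add.commute)
  qed
  \<comment> \<open>h \<circ> g is g plus d + 1 copies of h. Its coefficient is c + (d + 1) d by
    \<open>step\<close> but c + d by the homomorphism property.\<close>
  have "g \<oplus> [(Suc d)] \<cdot> h = h \<oplus> lam h g"
    by (simp add: d a_ac)
  then have "lam (g \<oplus> [(Suc d)] \<cdot> h) g = lam h (lam g g)"
    by (simp add: lam_circ del: add.nat_pow_Suc)
  then have "g \<oplus> [c] \<cdot> h \<oplus> [(Suc d * d)] \<cdot> h = g \<oplus> [d] \<cdot> h \<oplus> [c] \<cdot> h"
    unfolding step [OF g] by (simp add: c d hh lam_add lam_nat_pow)
  then have "[(d * d)] \<cdot> h \<oplus> (g \<oplus> [c] \<cdot> h \<oplus> [d] \<cdot> h) = \<zero> \<oplus> (g \<oplus> [c] \<cdot> h \<oplus> [d] \<cdot> h)"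
    by (simp add: add.nat_pow_mult [symmetric] a_ac)
  then have "[(d * d)] \<cdot> h = [(0::nat)] \<cdot> h"
    by (subst (asm) add.right_cancel) simp_all
  then have "p dvd d * d" unfolding h_eq by (simp add: cong_0_iff)
  then have "p dvd d" using prime_p by (simp add: prime_dvd_mult_iff)
  then have "[d] \<cdot> h = [(0::nat)] \<cdot> h" unfolding h_eq by (simp add: cong_0_iff)
  then have hg: "lam h g = g" by (simp add: d)
  obtain u v :: nat where u: "lam g z = [u] \<cdot> z" and v: "lam h z = [v] \<cdot> z"
    using genz Q_lam z(1) by (metis \<open>g \<in> carrier A\<close> \<open>h \<in> carrier A\<close>)
  have "adapted_brace A p q e c u v g h z"
  proof (intro adapted_brace.intro adapted_brace_axioms.intro)
    show "left_brace A" by (rule left_brace_axioms)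
    show "[q] \<cdot> z = \<zero>" using z(1) by (simp add: torsion_def)
    fix x assume "x \<in> carrier A"
    then show "\<exists>(i::nat) (j::nat) (k::nat). x = [i] \<cdot> g \<oplus> [j] \<cdot> h \<oplus> [k] \<cdot> z"
      using gen genz by (metis P_Q_decompose)
  qed (use prime_p prime_q p_gt_2 p_less_q card_carrier e h(3) c gh u hg hh v Q_fixes z in auto)
  then show thesis by (rule that)
qed

end

section \<open>Realization of the structure constants\<close>

lemma add_choose_two: "(a + b) choose 2 = (a choose 2) + (b choose 2) + a * b"
proof (induction a)
  case 0
  show ?case by (simp add: numeral_2_eq_2)
next
  case (Suc a)
  then show ?case by (simp add: numeral_2_eq_2)
qed

lemma dvd_mult_choose_two:
  assumes "odd n"
  shows "n dvd (n * k) choose 2"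
proof -
  have "even (n * k * (n * k - 1))" by (cases "n * k") simp_all
  then have "2 * ((n * k) choose 2) = n * k * (n * k - 1)" by (simp add: choose_two)
  then have "n dvd 2 * ((n * k) choose 2)" by (metis dvd_triv_left mult.assoc)
  moreover have "coprime n 2" using assms by simp
  ultimately show ?thesis by (simp add: coprime_dvd_mult_right_iff)
qed

fun triple_add :: "nat \<times> nat \<times> nat \<Rightarrow> nat \<times> nat \<times> nat \<Rightarrow> nat \<times> nat \<times> nat"
  where "triple_add (a, b, d) (i, j, k) = (a + i, b + j, d + k)"

text \<open>The formula is the one forced by \<open>mult_comb\<close>. Neither operation on triples
  reduces its result, so brace laws can be checked on plain naturals before \<open>reduce\<close> is
  applied.\<close>

fun triple_mult ::
  "nat \<Rightarrow> nat \<Rightarrow> nat \<Rightarrow> nat \<Rightarrow> nat \<Rightarrow> nat \<times> nat \<times> nat \<Rightarrow> nat \<times> nat \<times> nat \<Rightarrow> nat \<times> nat \<times> nat"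
  where "triple_mult p q c u v (a, b, d) (i, j, k) =
    (0, c * a * i, (chi p c u v a b + (q - 1)) * k)"

definition adapted_model ::
  "nat \<Rightarrow> nat \<Rightarrow> nat \<Rightarrow> nat \<Rightarrow> nat \<Rightarrow> nat \<Rightarrow> (nat \<times> nat \<times> nat) ring"
  where "adapted_model p q e c u v =
    \<lparr>carrier = {..<p} \<times> {..<p} \<times> {..<q},
     monoid.mult = (\<lambda>x y. reduce e p q (triple_mult p q c u v x y)), one = (0, 0, 0),
     zero = (0, 0, 0), add = (\<lambda>x y. reduce e p q (triple_add x y))\<rparr>"

locale adapted_params =
  fixes p q e c u v :: nat
  assumes prime_p: "prime p" and prime_q: "prime q" and p_gt_2: "2 < p" and p_less_q: "p < q"
    and v_pow_p: "[v ^ p = 1] (mod q)" and u_pow_p: "[u ^ p = v ^ e] (mod q)"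
begin

abbreviation "R \<equiv> reduce e p q"
abbreviation "M \<equiv> adapted_model p q e c u v"
abbreviation "mul \<equiv> triple_mult p q c u v"
abbreviation "X \<equiv> chi p c u v"

lemma p_pos [simp]: "0 < p" and q_pos [simp]: "0 < q"
  using prime_p prime_q prime_gt_0_nat by blast+

lemma v_pow_cong:
  assumes "[s = t] (mod p)"
  shows "[v ^ s = v ^ t] (mod q)"
proof -
  have *: "[v ^ (s + x * p) = v ^ s] (mod q)" for s x
    using cong_mult [OF cong_refl [of "v ^ s" q] cong_pow [OF v_pow_p, of x]]
    by (simp add: power_add power_mult mult.commute [of x])
  obtain x y where "s + x * p = t + y * p"
    using assms by (metis cong_iff_lin_nat)
  then show ?thesis
    using * [of s x] * [of t y] by (metis cong_sym cong_trans)
qed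

text \<open>The circle product of (a, b) and (a', b') is (a + a', b + b' + c a a').
  \<open>chi\<close> is multiplicative along it because the binomial of a sum exceeds the sum of
  binomials by a a', which enters with factor (p - 1) c and cancels c a a' modulo p.\<close>

lemma chi_add: "[X (a + a') (b + b' + c * a * a') = X a b * X a' b'] (mod q)"
proof -
  have "b + b' + c * a * a' + (p - 1) * c * ((a + a') choose 2) =
    (b + (p - 1) * c * (a choose 2)) + (b' + (p - 1) * c * (a' choose 2)) + p * (c * a * a')"
    using p_pos by (cases p) (simp_all add: add_choose_two algebra_simps)
  then have "[b + b' + c * a * a' + (p - 1) * c * ((a + a') choose 2) =
      (b + (p - 1) * c * (a choose 2)) + (b' + (p - 1) * c * (a' choose 2))] (mod p)"
    by (simp only: cong_def mod_mult_self2)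
  note v_pow_cong [OF this]
  from cong_mult [OF cong_refl [of "u ^ (a + a')"] this] show ?thesis
    by (simp add: chi_def power_add mult_ac)
qed

lemma chi_cong:
  assumes "[b = b'] (mod p)"
  shows "[X a b = X a b'] (mod q)"
  unfolding chi_def
  by (intro cong_mult cong_refl v_pow_cong cong_add assms)

text \<open>Compatibility with the carry: p t copies of g must act like e t copies of h. Oddness of
  p removes the binomial part.\<close>

lemma chi_p: "[X (p * t) 0 = v ^ (e * t)] (mod q)"
proof -
  obtain n where n: "(p * t) choose 2 = p * n"
    using dvd_mult_choose_two [of p t] prime_p p_gt_2 prime_odd_nat by blast
  have "[v ^ ((p - 1) * c * ((p * t) choose 2)) = v ^ 0] (mod q)"
    by (rule v_pow_cong) (simp add: n cong_def)
  from cong_mult [OF cong_pow [OF u_pow_p, of t] this] show ?thesis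
    by (simp add: chi_def power_mult [of u] power_mult [of v e])
qed

lemma chi_reduce: "[X (a mod p) ((b + e * (a div p)) mod p) = X a b] (mod q)"
proof -
  let ?r = "a mod p" and ?t = "a div p"
  have "[X a b = X (?r + p * ?t) (b + 0 + c * ?r * (p * ?t))] (mod q)"
  proof -
    have "b + 0 + c * ?r * (p * ?t) = b + p * (c * ?r * ?t)" by (simp add: mult_ac)
    then have "[b = b + 0 + c * ?r * (p * ?t)] (mod p)" by (simp only: cong_def mod_mult_self2)
    from chi_cong [OF this, of a] show ?thesis by simp
  qed
  also have "[X (?r + p * ?t) (b + 0 + c * ?r * (p * ?t)) = X ?r b * X (p * ?t) 0] (mod q)"
    by (rule chi_add)
  also have "[X ?r b * X (p * ?t) 0 = X ?r b * v ^ (e * ?t)] (mod q)"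
    by (intro cong_mult cong_refl chi_p)
  also have "X ?r b * v ^ (e * ?t) = X ?r (b + e * ?t)"
    by (simp add: chi_def power_add)
  also have "[X ?r (b + e * ?t) = X ?r ((b + e * ?t) mod p)] (mod q)"
    by (rule chi_cong) (simp add: cong_def)
  finally show ?thesis by (rule cong_sym)
qed

lemma chi_coprime: "coprime (X a b) q"
proof -
  have "coprime (v ^ p) q" using v_pow_p by (metis cong_imp_coprime cong_sym coprime_1_left)
  then have v: "coprime v q" using p_pos by simp
  then have "coprime (u ^ p) q" using u_pow_p by (metis cong_imp_coprime cong_sym coprime_power_left_iff)
  then have "coprime u q" using p_pos by simp
  with v show ?thesis by (simp add: chi_def)
qed

lemma reduce_id: "x \<in> {..<p} \<times> {..<p} \<times> {..<q} \<Longrightarrow> R x = x"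
  by (auto simp: reduce_def)

lemma reduce_in: "R x \<in> {..<p} \<times> {..<p} \<times> {..<q}"
  by (cases x) (simp add: reduce_def)

text \<open>With its companions below this removes inner reductions, so the laws of the model follow
  from statements on unreduced triples.\<close>

lemma reduce_add_left: "R (triple_add (R x) y) = R (triple_add x y)"
proof -
  obtain a b d where x: "x = (a, b, d)" by (cases x)
  obtain i j k where y: "y = (i, j, k)" by (cases y)
  have "(a + i) div p = a div p + (a mod p + i) div p"
  proof -
    have "a + i = (a mod p + i) + p * (a div p)" by simp
    then show ?thesis using p_pos div_mult_self2 [of p "a mod p + i" "a div p"] by (metis less_irrefl)
  qed
  then have "b + e * (a div p) + (j + e * ((a mod p + i) div p)) = b + j + e * ((a + i) div p)"
    by (simp add: algebra_simps)
  then have "((b + e * (a div p)) mod p + (j + e * ((a mod p + i) div p))) mod p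
      = (b + j + e * ((a + i) div p)) mod p"
    by (simp only: mod_add_left_eq)
  then show ?thesis by (simp add: x y reduce_def mod_simps add.assoc)
qed

lemma triple_add_commute: "triple_add x y = triple_add y x"
  by (cases x, cases y) simp

lemma triple_add_assoc: "triple_add (triple_add x y) w = triple_add x (triple_add y w)"
  by (cases x, cases y, cases w) simp

lemma reduce_add_right: "R (triple_add x (R y)) = R (triple_add x y)"
  using reduce_add_left [of y x] by (simp add: triple_add_commute)

lemma reduce_eq_iff: "R (0, j, k) = R (0, j', k') \<longleftrightarrow> [j = j'] (mod p) \<and> [k = k'] (mod q)"
  by (simp add: reduce_def cong_def)

lemma reduce_mult_right: "R (mul x (R y)) = R (mul x y)"
proof -
  obtain a b d where x: "x = (a, b, d)" by (cases x)
  obtain i j k where y: "y = (i, j, k)" by (cases y)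
  have "[c * a * (i mod p) = c * a * i] (mod p)" by (simp add: cong_def mod_simps)
  moreover have "[(X a b + (q - 1)) * (k mod q) = (X a b + (q - 1)) * k] (mod q)"
    by (intro cong_mult cong_refl) (simp add: cong_def)
  ultimately have "R (0, c * a * (i mod p), (X a b + (q - 1)) * (k mod q)) =
      R (0, c * a * i, (X a b + (q - 1)) * k)"
    by (simp only: reduce_eq_iff)
  then show ?thesis by (simp add: x y reduce_def)
qed

lemma reduce_mult_left: "R (mul (R x) y) = R (mul x y)"
proof -
  obtain a b d where x: "x = (a, b, d)" by (cases x)
  obtain i j k where y: "y = (i, j, k)" by (cases y)
  have "[c * (a mod p) * i = c * a * i] (mod p)"
    by (intro cong_mult cong_refl) (simp add: cong_def)
  moreover have "[(X (a mod p) ((b + e * (a div p)) mod p) + (q - 1)) * k =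
      (X a b + (q - 1)) * k] (mod q)"
    by (intro cong_mult cong_add cong_refl chi_reduce)
  ultimately have "R (0, c * (a mod p) * i, (X (a mod p) ((b + e * (a div p)) mod p) + (q - 1)) * k) =
      R (0, c * a * i, (X a b + (q - 1)) * k)"
    by (simp only: reduce_eq_iff)
  then show ?thesis by (simp add: x y reduce_def)
qed

lemma mult_add_right: "mul x (triple_add y w) = triple_add (mul x y) (mul x w)"
  by (cases x, cases y, cases w) (simp add: distrib_left)

text \<open>On the last coordinate this is A B - 1 = (A - 1) (B - 1) + (A - 1) + (B - 1) for the
  scalars A and B of \<open>x\<close> and \<open>y\<close>; \<open>chi_add\<close> gives the circle
  product the scalar A B.\<close>

lemma mult_circ:
  "R (mul (triple_add (triple_add (mul x y) x) y) w) =
   R (triple_add (triple_add (mul x (mul y w)) (mul x w)) (mul y w))"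
proof -
  obtain a b d where x: "x = (a, b, d)" by (cases x)
  obtain a' b' d' where y: "y = (a', b', d')" by (cases y)
  obtain i j k where w: "w = (i, j, k)" by (cases w)
  let ?r = "q - 1" and ?A = "X a b" and ?B = "X a' b'"
  let ?C = "X (a + a') (c * a * a' + b + b')"
  have r: "?r + 1 = q" using q_pos by simp
  have "[?C = ?A * ?B] (mod q)"
    using chi_add [of a a' b b'] by (simp add: add.assoc add.commute)
  then have "[(?C + ?r) * k = (?A * ?B + ?r) * k] (mod q)"
    by (intro cong_mult cong_add cong_refl)
  \<comment> \<open>With \<open>q - 1\<close> for minus one the identity is exact only after adding
    this multiple of q.\<close>
  also have "[(?A * ?B + ?r) * k = (?A * ?B + ?r + q * (?A + ?B + ?r)) * k] (mod q)"
    by (intro cong_mult cong_refl) (simp add: cong_def)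
  also have "(?A * ?B + ?r + q * (?A + ?B + ?r)) * k =
      (?A + ?r) * ((?B + ?r) * k) + (?A + ?r) * k + (?B + ?r) * k"
    by (subst r [symmetric], simp only: algebra_simps) (simp add: algebra_simps)
  finally have "[(?C + ?r) * k =
      (?A + ?r) * ((?B + ?r) * k) + (?A + ?r) * k + (?B + ?r) * k] (mod q)" .
  moreover have "c * (a + a') * i = c * a * i + c * a' * i" by (simp add: algebra_simps)
  ultimately have "R (0, c * (a + a') * i, (?C + ?r) * k) =
     R (0, c * a * i + c * a' * i, (?A + ?r) * ((?B + ?r) * k) + (?A + ?r) * k + (?B + ?r) * k)"
    by (simp only: reduce_eq_iff) simp
  then show ?thesis by (simp add: x y w)
qed

lemma abelian_group_model: "abelian_group M"
proof (rule abelian_groupI)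
  fix x assume "x \<in> carrier M"
  then have x: "x \<in> {..<p} \<times> {..<p} \<times> {..<q}" by (simp add: adapted_model_def)
  obtain i j k where ijk: "x = (i, j, k)" by (cases x)
  \<comment> \<open>\<open>p * p * q\<close> annihilates the additive group, so \<open>?n\<close>
    acts as minus one.\<close>
  let ?n = "p * p * q - 1"
  let ?y = "(?n * i, ?n * j, ?n * k)"
  have n: "?n * m + m = p * (p * q * m)" for m
  proof -
    have "?n + 1 = p * p * q" by simp
    then show ?thesis by (metis add_mult_distrib mult.assoc mult_1)
  qed
  have "R (triple_add ?y x) = (0, 0, 0)"
  proof -
    have "triple_add ?y x = (p * (p * q * i), p * (p * q * j), q * (p * p * k))"
      unfolding ijk triple_add.simps n by (simp add: mult_ac)
    moreover have "(p * (p * q * j) + e * (p * q * i)) mod p = 0"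
      by (simp add: mod_eq_0_iff_dvd)
    ultimately show ?thesis by (simp add: reduce_def)
  qed
  then have "R ?y \<oplus>\<^bsub>M\<^esub> x = \<zero>\<^bsub>M\<^esub>" by (simp add: adapted_model_def reduce_add_left)
  moreover have "R ?y \<in> carrier M" using reduce_in [of ?y] by (simp add: adapted_model_def)
  ultimately show "\<exists>y\<in>carrier M. y \<oplus>\<^bsub>M\<^esub> x = \<zero>\<^bsub>M\<^esub>" by blast
next
  fix x assume "x \<in> carrier M"
  then show "\<zero>\<^bsub>M\<^esub> \<oplus>\<^bsub>M\<^esub> x = x"
    by (cases x) (simp add: adapted_model_def reduce_id)
next
  fix x y show "x \<oplus>\<^bsub>M\<^esub> y = y \<oplus>\<^bsub>M\<^esub> x"
    by (simp add: adapted_model_def triple_add_commute)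
next
  fix x y w show "x \<oplus>\<^bsub>M\<^esub> y \<oplus>\<^bsub>M\<^esub> w = x \<oplus>\<^bsub>M\<^esub> (y \<oplus>\<^bsub>M\<^esub> w)"
    by (simp add: adapted_model_def reduce_add_left reduce_add_right triple_add_assoc)
qed (use reduce_in in \<open>auto simp: adapted_model_def\<close>)

lemma model_closed: "x \<oplus>\<^bsub>M\<^esub> y \<in> carrier M" "x \<otimes>\<^bsub>M\<^esub> y \<in> carrier M"
  using reduce_in by (simp_all add: adapted_model_def)

lemma model_lam: "(a, b, d) \<otimes>\<^bsub>M\<^esub> (i, j, k) \<oplus>\<^bsub>M\<^esub> (i, j, k) = R (i, j + c * a * i, X a b * k)"
proof -
  have "(X a b + (q - 1)) * k + k = X a b * k + q * k"
    using q_pos by (cases q) (auto simp: algebra_simps)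
  then have "((X a b + (q - 1)) * k + k) mod q = X a b * k mod q" by simp
  then show ?thesis
    by (simp add: adapted_model_def reduce_add_left) (simp add: reduce_def add_ac)
qed

lemma left_brace_model: "left_brace M"
proof (intro left_brace.intro left_brace_axioms.intro abelian_group_model)
  fix x assume x: "x \<in> carrier M"
  have inj: "inj_on (\<lambda>y. x \<otimes>\<^bsub>M\<^esub> y \<oplus>\<^bsub>M\<^esub> y) (carrier M)"
  proof (rule inj_onI)
    fix y y' assume yy: "y \<in> carrier M" "y' \<in> carrier M"
      and eq: "x \<otimes>\<^bsub>M\<^esub> y \<oplus>\<^bsub>M\<^esub> y = x \<otimes>\<^bsub>M\<^esub> y' \<oplus>\<^bsub>M\<^esub> y'"
    obtain a b d where x: "x = (a, b, d)" by (cases x)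
    obtain i j k where y: "y = (i, j, k)" by (cases y)
    obtain i' j' k' where y': "y' = (i', j', k')" by (cases y')
    have lt: "i < p" "j < p" "k < q" "i' < p" "j' < p" "k' < q"
      using yy by (simp_all add: y y' adapted_model_def)
    have R: "R (i, j + c * a * i, X a b * k) = R (i', j' + c * a * i', X a b * k')"
      using eq unfolding x y y' model_lam .
    then have i: "i = i'" using lt by (simp add: reduce_def)
    have "[j + c * a * i = j' + c * a * i] (mod p)" "[X a b * k = X a b * k'] (mod q)"
      using R lt by (simp_all add: i reduce_def cong_def)
    then have "[j = j'] (mod p)" "[k = k'] (mod q)"
      using chi_coprime by (simp_all add: cong_add_rcancel_nat cong_mult_lcancel_nat)
    then show "y = y'"
      using i lt by (simp add: y y' cong_less_modulus_unique_nat)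
  qed
  moreover have "(\<lambda>y. x \<otimes>\<^bsub>M\<^esub> y \<oplus>\<^bsub>M\<^esub> y) ` carrier M = carrier M"
  proof (rule endo_inj_surj [OF _ _ inj])
    show "finite (carrier M)" by (simp add: adapted_model_def)
  qed (use model_closed in blast)
  ultimately show "bij_betw (\<lambda>y. x \<otimes>\<^bsub>M\<^esub> y \<oplus>\<^bsub>M\<^esub> y) (carrier M) (carrier M)"
    by (simp add: bij_betw_def)
next
  fix x y w
  show "x \<otimes>\<^bsub>M\<^esub> (y \<oplus>\<^bsub>M\<^esub> w) = x \<otimes>\<^bsub>M\<^esub> y \<oplus>\<^bsub>M\<^esub> x \<otimes>\<^bsub>M\<^esub> w"
    by (simp add: adapted_model_def reduce_mult_right reduce_add_left reduce_add_right mult_add_right)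
  show "(x \<otimes>\<^bsub>M\<^esub> y \<oplus>\<^bsub>M\<^esub> x \<oplus>\<^bsub>M\<^esub> y) \<otimes>\<^bsub>M\<^esub> w =
    x \<otimes>\<^bsub>M\<^esub> (y \<otimes>\<^bsub>M\<^esub> w) \<oplus>\<^bsub>M\<^esub> x \<otimes>\<^bsub>M\<^esub> w \<oplus>\<^bsub>M\<^esub> y \<otimes>\<^bsub>M\<^esub> w"
    using mult_circ [of x y w]
    by (simp add: adapted_model_def reduce_mult_left reduce_mult_right reduce_add_left reduce_add_right)
qed (rule model_closed)

lemma adapted_brace_model: "adapted_brace M p q e c u v (1, 0, 0) (0, 1, 0) (0, 0, 1)"
proof -
  interpret left_brace M by (rule left_brace_model)
  have p1: "1 < p" "1 < q" using prime_p prime_q prime_gt_1_nat by auto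
  have pow: "[(n::nat)] \<cdot>\<^bsub>M\<^esub> (i, j, k) = R (n * i, n * j, n * k)" for n i j k
  proof (induction n)
    case 0
    then show ?case by (simp add: reduce_def) (simp add: adapted_model_def)
  next
    case (Suc n)
    have "[Suc n] \<cdot>\<^bsub>M\<^esub> (i, j, k) = R (n * i, n * j, n * k) \<oplus>\<^bsub>M\<^esub> (i, j, k)"
      by (simp add: Suc)
    then show ?case by (simp add: adapted_model_def reduce_add_left add.commute)
  qed
  have lam: "lam (a, b, d) (i, j, k) = R (i, j + c * a * i, X a b * k)" for a b d i j k
    unfolding lam_def model_lam ..
  have add: "R x \<oplus>\<^bsub>M\<^esub> R y = R (triple_add x y)" for x y
    by (simp add: adapted_model_def reduce_add_left reduce_add_right)
  have basis: "(1, 0, 0) = R (1, 0, 0)" "(0, 1, 0) = R (0, 1, 0)" "(0, 0, 1) = R (0, 0, 1)"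
    using p1 by (simp_all add: reduce_def)
  have zero: "\<zero>\<^bsub>M\<^esub> = (0, 0, 0)" by (simp add: adapted_model_def)
  have closed: "(1, 0, 0) \<in> carrier M" "(0, 1, 0) \<in> carrier M" "(0, 0, 1) \<in> carrier M"
    using p1 by (simp_all add: adapted_model_def)
  show ?thesis
  proof (intro adapted_brace.intro adapted_brace_axioms.intro left_brace_model)
    show "card (carrier M) = p\<^sup>2 * q"
      by (simp add: adapted_model_def card_cartesian_product power2_eq_square)
    show "lam (1, 0, 0) (1, 0, 0) = (1, 0, 0) \<oplus>\<^bsub>M\<^esub> [c] \<cdot>\<^bsub>M\<^esub> (0, 1, 0)"
      unfolding lam pow by (simp add: adapted_model_def reduce_add_right)
    fix x assume "x \<in> carrier M"
    then obtain i j k where x: "x = (i, j, k)" "R (i, j, k) = (i, j, k)"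
      using reduce_id by (cases x) (auto simp: adapted_model_def)
    have "x = [i] \<cdot>\<^bsub>M\<^esub> (1, 0, 0) \<oplus>\<^bsub>M\<^esub> [j] \<cdot>\<^bsub>M\<^esub> (0, 1, 0) \<oplus>\<^bsub>M\<^esub> [k] \<cdot>\<^bsub>M\<^esub> (0, 0, 1)"
      unfolding pow add by (simp add: x)
    then show "\<exists>(i::nat) (j::nat) (k::nat). x = [i] \<cdot>\<^bsub>M\<^esub> (1, 0, 0) \<oplus>\<^bsub>M\<^esub> [j] \<cdot>\<^bsub>M\<^esub> (0, 1, 0) \<oplus>\<^bsub>M\<^esub> [k] \<cdot>\<^bsub>M\<^esub> (0, 0, 1)"
      by blast
  qed (use closed p1 prime_p prime_q p_gt_2 p_less_q in
      \<open>simp_all add: pow lam zero reduce_def chi_def numeral_2_eq_2\<close>)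
qed

end

section \<open>Counting the orbits\<close>

lemma prime_root_of_unity:
  assumes "prime (q::nat)" "d dvd q - 1"
  obtains w where "ord q w = d" "\<And>x. [x ^ d = 1] (mod q) \<Longrightarrow> \<exists>r. [x = w ^ r] (mod q)"
proof -
  have q1: "1 < q" using assms(1) prime_gt_1_nat by blast
  obtain g where g: "residue_primroot q g" using prime_primitive_root_exists [OF q1 assms(1)] by blast
  then have ordg: "ord q g = q - 1" and cop: "coprime q g"
    using assms(1) by (simp_all add: residue_primroot_def totient_prime)
  obtain n where n: "q - 1 = d * n" using assms(2) by blast
  have pos: "0 < d" "0 < n" using n q1 by (cases d; cases n; simp)+
  \<comment> \<open>The witness is the (q - 1) / d-th power of a primitive root; a d-th root of
    unity has a discrete logarithm divisible by \<open>n\<close>.\<close>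
  show thesis
  proof (rule that [of "g ^ n"])
    show "ord q (g ^ n) = d"
      using pos by (simp only: ord_power [OF cop] ordg n) simp
    fix x assume x: "[x ^ d = 1] (mod q)"
    have "coprime (x ^ d) q"
      by (rule cong_imp_coprime [OF cong_sym [OF x]]) simp
    then have "coprime x q" using pos by simp
    then have "x mod q \<in> totatives q"
      using q1 by (auto simp: in_totatives_iff coprime_commute intro!: Nat.gr0I)
    then obtain a where "x mod q = g ^ a mod q"
      using residue_primroot_is_generator [OF q1 g] by (auto simp: bij_betw_def)
    then have a: "[x = g ^ a] (mod q)" by (simp add: cong_def)
    then have "[g ^ (a * d) = 1] (mod q)"
      using cong_pow [OF a, of d] x by (metis cong_sym cong_trans power_mult)
    then have "ord q g dvd a * d" by (simp only: ord_divides)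
    then have "d * n dvd a * d" by (simp only: ordg n)
    then have "n dvd a" using pos by (simp add: mult.commute)
    then obtain r where "a = n * r" by blast
    then show "\<exists>r. [x = (g ^ n) ^ r] (mod q)" using a by (auto simp: power_mult)
  qed
qed

lemma cong_power_iff_ord:
  fixes q :: nat
  assumes "ord q w = d" "0 < d"
  shows "[w ^ a = w ^ b] (mod q) \<longleftrightarrow> [a = b] (mod d)"
  using assms order_divides_expdiff [of q w a b] by (metis ord_eq_0 less_irrefl)

text \<open>The nonsquare is a primitive root g: its exponent 1 is odd while p - 1 is even. Dividing
  g^r by the square of g^(r div 2) leaves 1 or g.\<close>

lemma prime_nonsquare:
  assumes "prime (p::nat)" "2 < p"
  obtains n where "\<And>k. \<not> [k * k = n] (mod p)"
    "\<And>b. \<not> p dvd b \<Longrightarrow> \<exists>k. \<not> p dvd k \<and> ([b * (k * k) = 1] (mod p) \<or> [b * (k * k) = n] (mod p))"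
proof -
  obtain g where g: "ord p g = p - 1" "\<And>x. [x ^ (p - 1) = 1] (mod p) \<Longrightarrow> \<exists>r. [x = g ^ r] (mod p)"
    using prime_root_of_unity [OF assms(1), of "p - 1"] by auto
  have gen: "\<exists>r. [x = g ^ r] (mod p)" if "\<not> p dvd x" for x
    using that g(2) fermat_theorem [OF assms(1)] by blast
  have "coprime p g" using g(1) assms(2) by (metis diff_is_0_eq not_le ord_eq_0 less_trans one_less_numeral_iff semiring_norm(76))
  then have gp: "\<not> p dvd g ^ r" for r
    using assms(1) by (metis coprime_absorb_left coprime_power_right_iff not_prime_unit)
  show thesis
  proof (rule that [of g])
    fix k show "\<not> [k * k = g] (mod p)"
    proof
      assume k: "[k * k = g] (mod p)"
      have "\<not> p dvd k"
      proof
        assume "p dvd k"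
        then have "p dvd g" using k by (metis cong_dvd_iff dvd_mult2)
        then show False using gp [of 1] by simp
      qed
      then obtain r where r: "[k = g ^ r] (mod p)" using gen by blast
      have "[g ^ (2 * r) = g ^ 1] (mod p)"
        using cong_mult [OF r r] k by (simp add: mult_2 power_add) (metis cong_sym cong_trans)
      moreover have "0 < p - 1" using assms(2) by simp
      ultimately have "[2 * r = 1] (mod p - 1)"
        using cong_power_iff_ord [OF g(1)] by blast
      moreover have "2 dvd p - 1" using prime_odd_nat [OF assms(1)] assms(2) by simp
      ultimately have "[2 * r = 1] (mod 2)" by (rule cong_dvd_modulus_nat)
      then show False by (simp add: cong_def)
    qed
    fix b assume "\<not> p dvd b"
    then obtain r where r: "[b = g ^ r] (mod p)" using gen by blast
    have "coprime (g ^ (r div 2)) p"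
      using gp assms(1) by (metis coprime_commute prime_imp_coprime_nat)
    then obtain k where k: "[g ^ (r div 2) * k = 1] (mod p)"
      using cong_solve_coprime_nat [of "g ^ (r div 2)" p] by auto
    have "\<not> p dvd k"
    proof
      assume "p dvd k"
      then have "p dvd 1" using k by (metis cong_dvd_iff dvd_mult)
      then show False using assms(2) by simp
    qed
    moreover have "[b * (k * k) = g ^ (r mod 2)] (mod p)"
    proof -
      have "g ^ r = g ^ (r mod 2) * (g ^ (r div 2) * g ^ (r div 2))"
        by (simp add: power_add [symmetric]) (metis add.commute mult_2 mult_div_mod_eq)
      then have "g ^ r * (k * k) = g ^ (r mod 2) * ((g ^ (r div 2) * k) * (g ^ (r div 2) * k))"
        by (simp add: mult_ac)
      moreover have "[g ^ (r mod 2) * ((g ^ (r div 2) * k) * (g ^ (r div 2) * k)) =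
          g ^ (r mod 2) * (1 * 1)] (mod p)"
        by (intro cong_mult cong_refl k)
      moreover have "[b * (k * k) = g ^ r * (k * k)] (mod p)"
        by (rule cong_mult [OF r cong_refl])
      ultimately show ?thesis by (metis cong_trans mult_1_right)
    qed
    moreover have "r mod 2 = 0 \<or> r mod 2 = 1" by auto
    ultimately show "\<exists>k. \<not> p dvd k \<and> ([b * (k * k) = 1] (mod p) \<or> [b * (k * k) = g] (mod p))"
      by (metis power_0 power_one_right)
  qed
qed

lemma cong_linear_nat:
  assumes "coprime (b::nat) n" "0 < n"
  obtains m where "[b * m + s = t] (mod n)"
proof -
  obtain b' where "[b * b' = 1] (mod n)" using cong_solve_coprime_nat [OF assms(1)] by auto
  from cong_mult [OF this cong_refl [of "t + (n - 1) * s" n]]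
  have "[b * (b' * (t + (n - 1) * s)) + s = t + (n - 1) * s + s] (mod n)"
    by (intro cong_add cong_refl) (simp add: mult.assoc)
  also have "t + (n - 1) * s + s = t + n * s" using assms(2) by (cases n) simp_all
  also have "[\<dots> = t] (mod n)" by (simp add: cong_def)
  finally show thesis by (rule that)
qed

text \<open>\<open>S\<close> may be many-valued: isomorphic braces share all of it, and one common
  element already yields an isomorphism. So \<open>I\<close> counts classes once every
  \<open>S A\<close> meets it in exactly one point.\<close>

lemma num_braces_eq_card:
  fixes S :: "nat ring \<Rightarrow> 'i set"
  assumes realized: "\<And>i. i \<in> I \<Longrightarrow> \<exists>A \<in> braces_of_order n. i \<in> S A"
    and complete: "\<And>A. A \<in> braces_of_order n \<Longrightarrow> S A \<inter> I \<noteq> {}"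
    and unique: "\<And>A i j. A \<in> braces_of_order n \<Longrightarrow> i \<in> S A \<inter> I \<Longrightarrow> j \<in> S A \<inter> I \<Longrightarrow> i = j"
    and iso: "\<And>A B i. A \<in> braces_of_order n \<Longrightarrow> B \<in> braces_of_order n \<Longrightarrow> i \<in> S A \<Longrightarrow> i \<in> S B
      \<Longrightarrow> brace_iso A B \<noteq> {}"
    and inv: "\<And>A B. A \<in> braces_of_order n \<Longrightarrow> B \<in> braces_of_order n \<Longrightarrow> brace_iso A B \<noteq> {}
      \<Longrightarrow> S A \<subseteq> S B"
  shows "num_braces n = card I"
proof -
  obtain M where M: "\<And>i. i \<in> I \<Longrightarrow> M i \<in> braces_of_order n \<and> i \<in> S (M i)"
    using realized by metis
  let ?r = "brace_isomorphic n"
  let ?f = "\<lambda>i. ?r `` {M i}"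
  have "inj_on ?f I"
  proof (rule inj_onI)
    fix i j assume ij: "i \<in> I" "j \<in> I" and "?f i = ?f j"
    then have "(M i, M j) \<in> ?r"
      using eq_equiv_class [OF _ equiv_brace_isomorphic] M by blast
    then have "i \<in> S (M j)"
      using inv M ij by (auto simp: brace_isomorphic_def)
    then show "i = j" using unique M ij by blast
  qed
  moreover have "?f ` I = braces_of_order n // ?r"
  proof
    show "?f ` I \<subseteq> braces_of_order n // ?r"
      using M by (auto intro: quotientI)
    show "braces_of_order n // ?r \<subseteq> ?f ` I"
    proof
      fix K assume "K \<in> braces_of_order n // ?r"
      then obtain A where A: "A \<in> braces_of_order n" "K = ?r `` {A}" by (auto elim: quotientE)
      then obtain i where i: "i \<in> S A" "i \<in> I" using complete by blast
      then have "(A, M i) \<in> ?r" using iso A M by (auto simp: brace_isomorphic_def)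
      then have "K = ?f i" using A(2) equiv_class_eq [OF equiv_brace_isomorphic] by blast
      then show "K \<in> ?f ` I" using i by blast
    qed
  qed
  ultimately show ?thesis unfolding num_braces_def by (metis card_image)
qed

section \<open>Parameter sets as invariants of braces\<close>

definition basis_params :: "nat \<Rightarrow> nat \<Rightarrow> ('a, 'm) ring_scheme \<Rightarrow> (nat \<times> nat \<times> nat \<times> nat) set"
  where "basis_params p q A = {(e, c, u, v). \<exists>g h z. adapted_brace A p q e c u v g h z}"

lemma basis_params_cong:
  assumes "(e, c, u, v) \<in> basis_params p q A"
  shows "[v ^ p = 1] (mod q)" "[u ^ p = v ^ e] (mod q)"
  using assms adapted_brace.v_pow_p adapted_brace.u_pow_p by (fastforce simp: basis_params_def)+

text \<open>With \<open>k = l = 1\<close> and \<open>m = 0\<close> it also replaces the constants by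
  congruent ones.\<close>

lemma basis_params_change:
  assumes "(e, c, u, v) \<in> basis_params p q A" "coprime k p" "coprime l p"
    "[e * k = e' * l] (mod p)" "[c * k * k = c' * l] (mod p)"
    "[u' = u ^ k * v ^ (m + (p - 1) * c * (k choose 2))] (mod q)" "[v' = v ^ l] (mod q)"
  shows "(e', c', u', v') \<in> basis_params p q A"
proof -
  obtain g h z where "adapted_brace A p q e c u v g h z"
    using assms(1) by (auto simp: basis_params_def)
  then interpret adapted_brace A p q e c u v g h z .
  show ?thesis
    using change_basis [OF assms(2-5) assms(6) [folded chi_def] assms(7)]
    by (auto simp: basis_params_def)
qed

lemma basis_params_swap:
  assumes "(0, 0, u, v) \<in> basis_params p q A"
  shows "(0, 0, v, u) \<in> basis_params p q A"
  using assms adapted_brace.swap_basis by (fastforce simp: basis_params_def)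

lemma basis_params_second:
  assumes "(e, c, u, v) \<in> basis_params p q A" "(e', c', u', v') \<in> basis_params p q A"
  shows "e = 0 \<Longrightarrow> p dvd e'" "c = 0 \<Longrightarrow> p dvd c'"
    "\<exists>k m. [u' = u ^ k * v ^ m] (mod q)"
    "c' = 1 \<Longrightarrow> \<exists>k m. \<not> p dvd k \<and> [u' = u ^ k * v ^ m] (mod q) \<and> [v' = v ^ (c * k * k)] (mod q) \<and>
      [e * k = e' * (c * k * k)] (mod p)"
proof -
  obtain g h z where *: "adapted_brace A p q e c u v g h z"
    using assms(1) by (auto simp: basis_params_def)
  obtain g' h' z' where **: "adapted_brace A p q e' c' u' v' g' h' z'"
    using assms(2) by (auto simp: basis_params_def)
  interpret adapted_brace A p q e c u v g h z by fact
  show "e = 0 \<Longrightarrow> p dvd e'" "c = 0 \<Longrightarrow> p dvd c'"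
    using second_basis_e [OF **] second_basis_c [OF **] by blast+
  show "\<exists>k m. [u' = u ^ k * v ^ m] (mod q)"
    using second_basis [OF **] unfolding chi_def by metis
  show "\<exists>k m. \<not> p dvd k \<and> [u' = u ^ k * v ^ m] (mod q) \<and> [v' = v ^ (c * k * k)] (mod q) \<and>
      [e * k = e' * (c * k * k)] (mod p)" if "c' = 1"
    using second_basis_1 [OF ** [unfolded that]] unfolding chi_def by metis
qed

lemma basis_params_nonempty:
  assumes "prime p" "prime q" "2 < p" "p < q" "A \<in> braces_of_order (p\<^sup>2 * q)"
  shows "basis_params p q A \<noteq> {}"
proof -
  have "brace_p2q A p q"
    using assms by (simp add: brace_p2q_def brace_p2q_axioms_def braces_of_order_def)
  then interpret brace_p2q A p q .
  show ?thesis using adapted_basis_exists by (fastforce simp: basis_params_def)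
qed

lemma basis_params_realized:
  assumes "prime p" "prime q" "2 < p" "p < q" "[v ^ p = 1] (mod q)" "[u ^ p = v ^ e] (mod q)"
  shows "\<exists>A \<in> braces_of_order (p\<^sup>2 * q). (e, c, u, v) \<in> basis_params p q A"
proof -
  interpret adapted_params p q e c u v
    by unfold_locales (rule assms)+
  interpret M: adapted_brace M p q e c u v "(1, 0, 0)" "(0, 1, 0)" "(0, 0, 1)"
    by (rule adapted_brace_model)
  obtain B f where B: "B \<in> braces_of_order (p\<^sup>2 * q)" "f \<in> brace_iso M B"
    using nat_brace_representative [OF left_brace_model M.finite_carrier] M.card_carrier by auto
  then have "adapted_brace B p q e c u v (f (1, 0, 0)) (f (0, 1, 0)) (f (0, 0, 1))"
    using adapted_brace_iso [OF adapted_brace_model] by (auto simp: braces_of_order_def)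
  then show ?thesis using B(1) by (auto simp: basis_params_def)
qed

lemma basis_params_iso:
  assumes "i \<in> basis_params p q A" "i \<in> basis_params p q B"
  shows "brace_iso A B \<noteq> {}"
proof -
  obtain e c u v where i: "i = (e, c, u, v)" by (cases i)
  obtain g h z where "adapted_brace A p q e c u v g h z"
    using assms(1) by (auto simp: i basis_params_def)
  moreover obtain g' h' z' where "adapted_brace B p q e c u v g' h' z'"
    using assms(2) by (auto simp: i basis_params_def)
  ultimately show ?thesis by (rule adapted_brace_isomorphic)
qed

lemma basis_params_mono:
  "left_brace B \<Longrightarrow> brace_iso A B \<noteq> {} \<Longrightarrow> basis_params p q A \<subseteq> basis_params p q B"
  using adapted_brace_iso by (fastforce simp: basis_params_def)

locale normal_params =
  fixes p q w t n :: nat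
  assumes prime_p: "prime p" and prime_q: "prime q" and p_gt_2: "2 < p" and p_less_q: "p < q"
    and ord_w: "p dvd q - 1 \<Longrightarrow> ord q w = p"
    and root_w: "\<And>x. p dvd q - 1 \<Longrightarrow> [x ^ p = 1] (mod q) \<Longrightarrow> \<exists>r. [x = w ^ r] (mod q)"
    and ord_t: "p\<^sup>2 dvd q - 1 \<Longrightarrow> ord q t = p\<^sup>2"
    and root_t: "\<And>x. p\<^sup>2 dvd q - 1 \<Longrightarrow> [x ^ p\<^sup>2 = 1] (mod q) \<Longrightarrow> \<exists>r. [x = t ^ r] (mod q)"
    and nonsquare: "\<And>k. \<not> [k * k = n] (mod p)"
    and square_class: "\<And>b. \<not> p dvd b \<Longrightarrow>
      \<exists>k. \<not> p dvd k \<and> ([b * (k * k) = 1] (mod p) \<or> [b * (k * k) = n] (mod p))"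
begin

text \<open>Here \<open>w\<close> and \<open>t\<close> are roots of unity modulo \<open>q\<close> of order \<open>p\<close> and \<open>p\<^sup>2\<close> (when they exist) and \<open>n\<close> is a
  nonsquare modulo \<open>p\<close>.  The set \<open>S\<close> with index \<open>e c\<close> contains one pair \<open>(u, v)\<close> per class.\<close>

definition U :: "nat set"
  where "U = {x \<in> {..<q}. [x ^ p = 1] (mod q)}"
definition S00 :: "(nat \<times> nat) set"
  where "S00 = insert (1, 1) (if p dvd q - 1 then {(w, 1)} else {})"
definition S01 :: "(nat \<times> nat) set"
  where "S01 = insert (1, 1) (if p dvd q - 1 then {(w, 1), (1, w), (1, w ^ n)} else {})"
definition S10 :: "(nat \<times> nat) set"
  where "S10 = insert (1, 1)
  ((if p dvd q - 1 then {(w, 1)} else {}) \<union> (if p\<^sup>2 dvd q - 1 then {(t, t ^ p)} else {}))"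
definition S11 :: "(nat \<times> nat) set"
  where "S11 = U \<times> {1} \<union> (if p\<^sup>2 dvd q - 1 then (\<lambda>r. (t ^ r, t ^ (p * r))) ` {1..<p} else {})"
definition normal_forms :: "(nat \<times> nat \<times> nat \<times> nat) set"
  where "normal_forms =
  {0} \<times> {0} \<times> S00 \<union> {0} \<times> {1} \<times> S01 \<union> {1} \<times> {0} \<times> S10 \<union> {1} \<times> {1} \<times> S11"

section \<open>Roots of unity modulo q and the number of normal forms\<close>

lemma p_pos: "0 < p" and p_gt_1: "1 < p" and q_gt_1: "1 < q"
  using p_gt_2 p_less_q by simp_all

lemma p2_imp_p: "p\<^sup>2 dvd q - 1 \<Longrightarrow> p dvd q - 1"
  by (metis dvd_mult_left power2_eq_square)

lemma w_cong: "p dvd q - 1 \<Longrightarrow> [w ^ a = w ^ b] (mod q) \<longleftrightarrow> [a = b] (mod p)"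
  by (rule cong_power_iff_ord [OF ord_w p_pos])

lemma t_cong: "p\<^sup>2 dvd q - 1 \<Longrightarrow> [t ^ a = t ^ b] (mod q) \<longleftrightarrow> [a = b] (mod p\<^sup>2)"
  by (rule cong_power_iff_ord [OF ord_t]) (use p_pos in simp_all)

lemma w_cong_1: "p dvd q - 1 \<Longrightarrow> [w ^ a = 1] (mod q) \<longleftrightarrow> p dvd a"
  using w_cong [of a 0] by (simp add: cong_0_iff)

lemma t_cong_1: "p\<^sup>2 dvd q - 1 \<Longrightarrow> [t ^ a = 1] (mod q) \<longleftrightarrow> p\<^sup>2 dvd a"
  using t_cong [of a 0] by (simp add: cong_0_iff)

lemma t_pow_p_not_1: "p\<^sup>2 dvd q - 1 \<Longrightarrow> 0 < r \<Longrightarrow> r < p \<Longrightarrow> \<not> [t ^ (p * r) = 1] (mod q)"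
  using t_cong_1 [of "p * r"] by (auto simp: power2_eq_square dest: dvd_imp_le)

lemma ord_dvd_q: "coprime x q \<Longrightarrow> ord q x dvd q - 1"
  using order_divides_totient [of q x] prime_q by (simp add: totient_prime coprime_commute)

lemma root_coprime:
  assumes "[x ^ a = 1] (mod q)" "0 < a"
  shows "coprime x q"
proof -
  have "coprime (x ^ a) q" by (rule cong_imp_coprime [OF cong_sym [OF assms(1)]]) simp
  then show ?thesis using assms(2) by simp
qed

lemma root_trivial:
  assumes "\<not> p dvd q - 1" "[x ^ p = 1] (mod q)"
  shows "[x = 1] (mod q)"
proof -
  have "ord q x dvd p" using assms(2) by (simp only: ord_divides)
  moreover have "ord q x \<noteq> p"
    using ord_dvd_q [OF root_coprime [OF assms(2) p_pos]] assms(1) by auto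
  ultimately have "ord q x = 1" using prime_p prime_nat_iff by blast
  then show ?thesis using ord_eq_Suc_0_iff [of q x] by simp
qed

lemma root_p:
  assumes "\<not> p\<^sup>2 dvd q - 1" "[x ^ p\<^sup>2 = 1] (mod q)"
  shows "[x ^ p = 1] (mod q)"
proof -
  have "ord q x dvd p\<^sup>2" using assms(2) by (simp only: ord_divides)
  then obtain k where k: "k \<le> 2" "ord q x = p ^ k"
    using divides_primepow_nat [OF prime_p] by blast
  have "coprime x q" using root_coprime [OF assms(2)] p_pos by simp
  then have "k \<noteq> 2" using ord_dvd_q [of x] k assms(1) by auto
  then have "k = 0 \<or> k = 1" using k by linarith
  then have "ord q x dvd p" using k by auto
  then show ?thesis by (simp only: ord_divides)
qed

lemma w_not_cong_1: "p dvd q - 1 \<Longrightarrow> \<not> [w = 1] (mod q)"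
  using w_cong_1 [of 1] p_gt_1 by simp

lemma n_props: "\<not> p dvd n" "\<not> [n = 1] (mod p)"
proof -
  show "\<not> p dvd n" using nonsquare [of 0] by (metis cong_0_iff cong_sym mult_0)
  show "\<not> [n = 1] (mod p)" using nonsquare [of 1] by (metis cong_sym mult_1)
qed

lemma valid:
  assumes "(e, c, u, v) \<in> normal_forms"
  shows "[v ^ p = 1] (mod q)" "[u ^ p = v ^ e] (mod q)"
proof -
  have w: "[w ^ p = 1] (mod q)" "[(w ^ n) ^ p = 1] (mod q)" if "p dvd q - 1"
    using w_cong_1 [OF that] by (simp_all add: power_mult [symmetric])
  have t: "[(t ^ (p * r)) ^ p = 1] (mod q)" if "p\<^sup>2 dvd q - 1" for r
    using t_cong_1 [OF that, of "p * r * p"]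
    by (simp add: power_mult [symmetric] power2_eq_square mult_ac)
  have tp: "(t ^ r) ^ p = t ^ (p * r)" for r
    by (simp add: power_mult [symmetric] mult.commute)
  show "[v ^ p = 1] (mod q)" "[u ^ p = v ^ e] (mod q)"
    using assms w t [of 1] t
    by (auto simp: normal_forms_def S00_def S01_def S10_def S11_def U_def tp split: if_splits)
qed

lemma finite_U: "finite U"
  by (simp add: U_def)

lemma card_U: "card U = (if p dvd q - 1 then p else 1)"
proof (cases "p dvd q - 1")
  case True
  have "inj_on (\<lambda>r. w ^ r mod q) {..<p}"
  proof (rule inj_onI)
    fix r s assume rs: "r \<in> {..<p}" "s \<in> {..<p}" and "w ^ r mod q = w ^ s mod q"
    then have "[r = s] (mod p)" by (simp add: cong_def w_cong [OF True, unfolded cong_def])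
    then show "r = s" using rs by (simp add: cong_less_modulus_unique_nat)
  qed
  moreover have "(\<lambda>r. w ^ r mod q) ` {..<p} = U"
  proof
    show "(\<lambda>r. w ^ r mod q) ` {..<p} \<subseteq> U"
      using w_cong_1 [OF True] q_gt_1
      by (auto simp: U_def cong_def power_mod power_mult [symmetric])
    show "U \<subseteq> (\<lambda>r. w ^ r mod q) ` {..<p}"
    proof
      fix x assume x: "x \<in> U"
      then obtain r where r: "[x = w ^ r] (mod q)" using root_w [OF True] by (auto simp: U_def)
      have "[w ^ r = w ^ (r mod p)] (mod q)" using w_cong [OF True] by (simp add: cong_def)
      with r have "[x = w ^ (r mod p)] (mod q)" by (rule cong_trans)
      then have "x = w ^ (r mod p) mod q" using x by (simp add: U_def cong_def)
      then show "x \<in> (\<lambda>r. w ^ r mod q) ` {..<p}" using p_pos by auto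
    qed
  qed
  ultimately show ?thesis using True by (metis card_image card_lessThan)
next
  case False
  have "U = {1}"
  proof
    show "U \<subseteq> {1}"
    proof
      fix x assume x: "x \<in> U"
      then have "[x = 1] (mod q)" using root_trivial [OF False] by (simp add: U_def)
      then show "x \<in> {1}"
        using x q_gt_1 cong_less_modulus_unique_nat [of x 1 q] by (simp add: U_def)
    qed
    show "{1} \<subseteq> U" using q_gt_1 by (simp add: U_def)
  qed
  then show ?thesis using False by simp
qed

lemma w_neq: "p dvd q - 1 \<Longrightarrow> w \<noteq> 1" "p dvd q - 1 \<Longrightarrow> w ^ n \<noteq> 1" "p dvd q - 1 \<Longrightarrow> w ^ n \<noteq> w"
proof -
  assume p: "p dvd q - 1"
  show "w \<noteq> 1" using w_not_cong_1 [OF p] by auto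
  show "w ^ n \<noteq> 1"
    using w_cong_1 [OF p, of n] n_props by (metis cong_refl)
  show "w ^ n \<noteq> w"
    using w_cong [OF p, of n 1] n_props by (metis cong_refl power_one_right)
qed

lemma t_neq: "p\<^sup>2 dvd q - 1 \<Longrightarrow> 0 < r \<Longrightarrow> r < p \<Longrightarrow> t ^ (p * r) \<noteq> 1"
  using t_pow_p_not_1 by (metis cong_refl)

lemma t_inj: "p\<^sup>2 dvd q - 1 \<Longrightarrow> inj_on (\<lambda>r. (t ^ r, t ^ (p * r))) {1..<p}"
proof (rule inj_onI)
  fix r s assume p: "p\<^sup>2 dvd q - 1" and rs: "r \<in> {1..<p}" "s \<in> {1..<p}"
    and eq: "(t ^ r, t ^ (p * r)) = (t ^ s, t ^ (p * s))"
  then have "[r = s] (mod p\<^sup>2)" using t_cong [OF p, of r s] by simp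
  moreover have "p \<le> p\<^sup>2" using p_pos by (simp add: power2_eq_square)
  ultimately show "r = s" using rs by (auto simp: cong_less_modulus_unique_nat)
qed

lemma finite_S: "finite S00" "finite S01" "finite S10" "finite S11"
  by (simp_all add: S00_def S01_def S10_def S11_def finite_U)

lemma card_normal_forms:
  "card normal_forms = card S00 + card S01 + card S10 + card S11"
proof -
  let ?A = "{0::nat} \<times> {0::nat} \<times> S00" and ?B = "{0::nat} \<times> {1::nat} \<times> S01"
  let ?C = "{1::nat} \<times> {0::nat} \<times> S10" and ?D = "{1::nat} \<times> {1::nat} \<times> S11"
  have "card (?A \<union> ?B) = card ?A + card ?B"
    by (rule card_Un_disjoint) (use finite_S in auto)
  moreover have "card (?A \<union> ?B \<union> ?C) = card (?A \<union> ?B) + card ?C"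
    by (rule card_Un_disjoint) (use finite_S in auto)
  moreover have "card (?A \<union> ?B \<union> ?C \<union> ?D) = card (?A \<union> ?B \<union> ?C) + card ?D"
    by (rule card_Un_disjoint) (use finite_S in auto)
  ultimately show ?thesis by (simp add: normal_forms_def card_cartesian_product)
qed

text \<open>In the order \<open>S00\<close>, \<open>S01\<close>, \<open>S10\<close>,
  \<open>S11\<close> the sizes are 2, 4, 3, 2p - 1 if p^2 divides q - 1; 2, 4, 2, p if only p does;
  and 1, 1, 1, 1 otherwise.\<close>

lemma card_normal_forms_eq:
  "card normal_forms =
    (if p\<^sup>2 dvd q - 1 then 2 * p + 8 else if p dvd q - 1 then p + 8 else 4)"
proof -
  have t: "t ^ p \<noteq> 1" if "p\<^sup>2 dvd q - 1" using t_neq [OF that, of 1] p_gt_1 by simp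
  have "card (U \<times> {1::nat} \<union> (\<lambda>r. (t ^ r, t ^ (p * r))) ` {1..<p}) = card U + (p - 1)"
    if "p\<^sup>2 dvd q - 1"
  proof -
    have "card ((\<lambda>r. (t ^ r, t ^ (p * r))) ` {1..<p}) = p - 1"
      by (subst card_image [OF t_inj [OF that]]) simp
    moreover have "U \<times> {1} \<inter> (\<lambda>r. (t ^ r, t ^ (p * r))) ` {1..<p} = {}"
    proof (rule equals0I)
      fix x assume "x \<in> U \<times> {1} \<inter> (\<lambda>r. (t ^ r, t ^ (p * r))) ` {1..<p}"
      then obtain r where "r \<in> {1..<p}" "x = (t ^ r, t ^ (p * r))" "snd x = 1" by force
      then show False using t_neq [OF that, of r] by simp
    qed
    ultimately show ?thesis
      using finite_U by (subst card_Un_disjoint) (simp_all add: card_cartesian_product)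
  qed
  then have "card S11 = card U + (if p\<^sup>2 dvd q - 1 then p - 1 else 0)"
    by (simp add: S11_def card_cartesian_product)
  moreover have "card S00 = (if p dvd q - 1 then 2 else 1)"
    using w_neq(1) [THEN not_sym] by (simp add: S00_def)
  moreover have "card S01 = (if p dvd q - 1 then 4 else 1)"
    using w_neq w_neq [THEN not_sym] by (auto simp: S01_def card_insert_if)
  moreover have "card S10 = (if p dvd q - 1 then 2 else 1) + (if p\<^sup>2 dvd q - 1 then 1 else 0)"
    using w_neq t p2_imp_p by (auto simp: S10_def)
  ultimately show ?thesis
    using p2_imp_p p_pos by (auto simp: card_normal_forms card_U)
qed

section \<open>Reaching a normal form\<close>

lemma not_dvd_coprime: "\<not> p dvd k \<Longrightarrow> coprime k p"
  using prime_p by (metis coprime_commute prime_imp_coprime_nat)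

lemma inverse_mod_p:
  assumes "\<not> p dvd a"
  obtains k where "\<not> p dvd k" "[a * k = 1] (mod p)"
proof -
  obtain k where k: "[a * k + 0 = 1] (mod p)"
    using cong_linear_nat [OF not_dvd_coprime [OF assms] p_pos] by metis
  have "\<not> p dvd k"
  proof
    assume "p dvd k"
    then have "p dvd 1" using k by (metis add_0_right cong_dvd_iff dvd_mult)
    then show False using p_gt_1 by simp
  qed
  then show thesis using that k by simp
qed

lemma normalize_e_c:
  assumes "(e, c, u, v) \<in> basis_params p q A"
  obtains e' c' u' v' where "e' \<in> {0, 1}" "c' \<in> {0, 1}" "(e', c', u', v') \<in> basis_params p q A"
proof -
  have "\<exists>e' \<in> {0, 1}. \<exists>c u v. (e', c, u, v) \<in> basis_params p q A"
  proof (cases "p dvd e")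
    case True
    then have "(0, c, u, v) \<in> basis_params p q A"
      by (intro basis_params_change [OF assms, of 1 1 _ _ _ 0]) (simp_all add: cong_0_iff numeral_2_eq_2)
    then show ?thesis by blast
  next
    case False
    obtain c' where "[e * c' + 0 = c] (mod p)"
      using cong_linear_nat [OF not_dvd_coprime [OF False] p_pos] by metis
    \<comment> \<open>Scaling h by \<open>e\<close> makes the first constant 1; \<open>c'\<close> is
      the quotient of \<open>c\<close> by \<open>e\<close> modulo p.\<close>
    then have "(1, c', u, v ^ e) \<in> basis_params p q A"
      by (intro basis_params_change [OF assms, of 1 e _ _ _ 0])
        (simp_all add: not_dvd_coprime [OF False] cong_sym_eq mult.commute numeral_2_eq_2)
    then show ?thesis by blast
  qed
  then obtain e c u v where e: "e \<in> {0, 1}" and *: "(e, c, u, v) \<in> basis_params p q A" by blast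
  show thesis
  proof (cases "p dvd c")
    case True
    then have "(e, 0, u, v) \<in> basis_params p q A"
      by (intro basis_params_change [OF *, of 1 1 _ _ _ 0]) (simp_all add: cong_0_iff numeral_2_eq_2)
    then show thesis using that e by blast
  next
    case False
    obtain k where k: "\<not> p dvd k" "[c * k = 1] (mod p)"
      using inverse_mod_p [OF False] by metis
    have "[c * k * k = 1 * k] (mod p)" using k(2) by (intro cong_mult cong_refl)
    \<comment> \<open>Scaling g and h by the same \<open>k\<close> keeps \<open>e\<close> and turns
      the second constant into c k = 1.\<close>
    then have "(e, 1, u ^ k * v ^ (0 + (p - 1) * c * (k choose 2)), v ^ k) \<in> basis_params p q A"
      by (intro basis_params_change [OF *, of k k _ _ _ 0]) (use k(1) not_dvd_coprime in simp_all)
    then show thesis using that e by blast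
  qed
qed

lemma pow_cong_1: "[x = 1] (mod q) \<Longrightarrow> [x ^ m = 1] (mod q)"
  using cong_pow [of x 1 q m] by simp

lemma root_cases:
  assumes "[x ^ p = 1] (mod q)" "\<not> [x = 1] (mod q)"
  obtains a where "p dvd q - 1" "\<not> p dvd a" "[x = w ^ a] (mod q)"
proof -
  have p: "p dvd q - 1" using root_trivial assms by blast
  obtain a where a: "[x = w ^ a] (mod q)" using root_w [OF p assms(1)] by blast
  have "\<not> p dvd a"
    using w_cong_1 [OF p, of a] a assms(2) by (metis cong_trans)
  then show thesis using that p a by blast
qed

text \<open>With v trivial, u is a p-th root of unity and scaling g by \<open>k\<close> replaces it
  by u^k, so every nontrivial root can be turned into \<open>w\<close>.\<close>

lemma complete_c0_v1:
  assumes "(e, 0, u, v) \<in> basis_params p q A" "[v = 1] (mod q)"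
  shows "(e, 0, 1, 1) \<in> basis_params p q A \<or> p dvd q - 1 \<and> (e, 0, w, 1) \<in> basis_params p q A"
proof (cases "[u = 1] (mod q)")
  case True
  then have "(e, 0, 1, 1) \<in> basis_params p q A"
    using assms(2) by (intro basis_params_change [OF assms(1), of 1 1 _ _ _ 0]) (simp_all add: cong_sym)
  then show ?thesis ..
next
  case False
  have "[u ^ p = v ^ e] (mod q)" by (rule basis_params_cong [OF assms(1)])
  then have "[u ^ p = 1] (mod q)" using pow_cong_1 [OF assms(2)] by (rule cong_trans)
  then obtain a where p: "p dvd q - 1" and a: "\<not> p dvd a" "[u = w ^ a] (mod q)"
    using False root_cases by metis
  obtain k where k: "\<not> p dvd k" "[a * k = 1] (mod p)" using inverse_mod_p [OF a(1)] by metis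
  have "[w ^ (a * k) = w ^ 1] (mod q)" using w_cong [OF p] k by blast
  moreover have "[u ^ k = w ^ (a * k)] (mod q)" using cong_pow [OF a(2), of k] by (simp add: power_mult)
  ultimately have "[w = u ^ k] (mod q)" by (metis cong_sym cong_trans power_one_right)
  then have "(e, 0, w, 1) \<in> basis_params p q A"
    using k not_dvd_coprime pow_cong_1 [OF assms(2)]
    by (intro basis_params_change [OF assms(1), of k k _ _ _ 0]) (simp_all add: cong_sym)
  with p show ?thesis by blast
qed

text \<open>A nontrivial v generates all p-th roots of unity, so adding copies of h to g kills u;
  exchanging g and h then moves the nontrivial root to the first place.\<close>

lemma complete_00:
  assumes "(0, 0, u, v) \<in> basis_params p q A"
  shows "\<exists>s \<in> S00. (0, 0, s) \<in> basis_params p q A"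
proof -
  have "\<exists>u v. (0, 0, u, v) \<in> basis_params p q A \<and> [v = 1] (mod q)"
  proof (cases "[v = 1] (mod q)")
    case True
    then show ?thesis using assms by blast
  next
    case False
    have v: "[v ^ p = 1] (mod q)" "[u ^ p = 1] (mod q)"
      using basis_params_cong [OF assms] by simp_all
    then obtain b where p: "p dvd q - 1" and b: "\<not> p dvd b" "[v = w ^ b] (mod q)"
      using False root_cases by metis
    obtain a where a: "[u = w ^ a] (mod q)" using root_w [OF p v(2)] by blast
    obtain m where "[b * m + a = 0] (mod p)"
      using cong_linear_nat [OF not_dvd_coprime [OF b(1)] p_pos] by metis
    then have "[w ^ (b * m + a) = 1] (mod q)" using w_cong_1 [OF p] by (simp add: cong_0_iff)
    moreover have "[u * v ^ m = w ^ (b * m + a)] (mod q)"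
      using cong_mult [OF a cong_pow [OF b(2), of m]] by (simp add: power_add power_mult mult.commute)
    ultimately have "[1 = u * v ^ m] (mod q)" by (metis cong_sym cong_trans)
    then have "(0, 0, 1, v) \<in> basis_params p q A"
      by (intro basis_params_change [OF assms, of 1 1 _ _ _ m]) simp_all
    then have "(0, 0, v, 1) \<in> basis_params p q A" by (rule basis_params_swap)
    then show ?thesis by (meson cong_refl)
  qed
  then show ?thesis using complete_c0_v1 by (fastforce simp: S00_def)
qed

text \<open>If v is nontrivial, adding copies of h to g kills u. Keeping c = 1 forces l = k^2, so
  the exponent of v moves within its square class and reaches 1 or \<open>n\<close>.\<close>

lemma complete_01:
  assumes "(0, 1, u, v) \<in> basis_params p q A"
  shows "\<exists>s \<in> S01. (0, 1, s) \<in> basis_params p q A"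
proof -
  have v: "[v ^ p = 1] (mod q)" "[u ^ p = 1] (mod q)"
    using basis_params_cong [OF assms] by simp_all
  show ?thesis
  proof (cases "[v = 1] (mod q)")
    case v1: True
    show ?thesis
    proof (cases "[u = 1] (mod q)")
      case True
      then have "(0, 1, 1, 1) \<in> basis_params p q A"
        using v1 by (intro basis_params_change [OF assms, of 1 1 _ _ _ 0])
          (simp_all add: cong_sym numeral_2_eq_2)
      then show ?thesis by (auto simp: S01_def)
    next
      case False
      then obtain a where p: "p dvd q - 1" and a: "\<not> p dvd a" "[u = w ^ a] (mod q)"
        using root_cases [OF v(2)] by metis
      obtain k where k: "\<not> p dvd k" "[a * k = 1] (mod p)" using inverse_mod_p [OF a(1)] by metis
      have "[w ^ (a * k) = w ^ 1] (mod q)" using w_cong [OF p] k by blast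
      moreover have "[u ^ k * v ^ m = w ^ (a * k)] (mod q)" for m
        using cong_mult [OF cong_pow [OF a(2), of k] pow_cong_1 [OF v1, of m]]
        by (simp add: power_mult)
      ultimately have "[w = u ^ k * v ^ m] (mod q)" for m by (metis cong_sym cong_trans power_one_right)
      then have "(0, 1, w, 1) \<in> basis_params p q A"
        using k not_dvd_coprime prime_p cong_sym [OF pow_cong_1 [OF v1, of "k * k"]]
        by (intro basis_params_change [OF assms, of k "k * k" _ _ _ 0]) simp_all
      then show ?thesis using p by (auto simp: S01_def)
    qed
  next
    case False
    then obtain b where p: "p dvd q - 1" and b: "\<not> p dvd b" "[v = w ^ b] (mod q)"
      using root_cases [OF v(1)] by metis
    obtain a where a: "[u = w ^ a] (mod q)" using root_w [OF p v(2)] by blast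
    obtain k where k: "\<not> p dvd k" "[b * (k * k) = 1] (mod p) \<or> [b * (k * k) = n] (mod p)"
      using square_class [OF b(1)] by blast
    \<comment> \<open>\<open>?s\<close> is the binomial correction of \<open>chi\<close> for c = 1;
      \<open>m\<close> is solved to cancel it together with u^k.\<close>
    let ?s = "(p - 1) * 1 * (k choose 2)"
    obtain m where m: "[b * m + (a * k + b * ?s) = 0] (mod p)"
      using cong_linear_nat [OF not_dvd_coprime [OF b(1)] p_pos] by metis
    have "[u ^ k * v ^ (m + ?s) = (w ^ a) ^ k * (w ^ b) ^ (m + ?s)] (mod q)"
      by (intro cong_mult cong_pow a b)
    also have "(w ^ a) ^ k * (w ^ b) ^ (m + ?s) = w ^ (b * m + (a * k + b * ?s))"
      by (simp add: power_mult [symmetric] power_add [symmetric] algebra_simps)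
    also have "[w ^ (b * m + (a * k + b * ?s)) = 1] (mod q)"
      using w_cong_1 [OF p] m by (simp add: cong_0_iff)
    finally have u': "[1 = u ^ k * v ^ (m + ?s)] (mod q)" by (rule cong_sym)
    have v': "[w ^ r = v ^ (k * k)] (mod q)" if "[b * (k * k) = r] (mod p)" for r
    proof -
      have "[w ^ (b * (k * k)) = w ^ r] (mod q)" using w_cong [OF p] that by blast
      moreover have "[v ^ (k * k) = w ^ (b * (k * k))] (mod q)"
        using cong_pow [OF b(2), of "k * k"] by (simp add: power_mult)
      ultimately show ?thesis by (metis cong_sym cong_trans)
    qed
    have "(0, 1, 1, w ^ r) \<in> basis_params p q A" if "[b * (k * k) = r] (mod p)" for r
      by (rule basis_params_change [OF assms, of k "k * k" _ _ _ m])
        (use k not_dvd_coprime u' v' [OF that] in simp_all)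
    then show ?thesis using k(2) p by (force simp: S01_def)
  qed
qed

text \<open>For e = 1 one has v = u^p, so a nontrivial v makes u a root of unity of order
  p^2.\<close>

lemma complete_1_v:
  assumes "(1, c, u, v) \<in> basis_params p q A" "\<not> [v = 1] (mod q)"
  obtains a where "p\<^sup>2 dvd q - 1" "\<not> p dvd a" "[u = t ^ a] (mod q)" "[v = t ^ (p * a)] (mod q)"
proof -
  have v: "[v ^ p = 1] (mod q)" "[u ^ p = v] (mod q)"
    using basis_params_cong [OF assms(1)] by simp_all
  have u: "[u ^ p\<^sup>2 = 1] (mod q)"
    using cong_trans [OF cong_pow [OF v(2), of p] v(1)] by (simp add: power_mult power2_eq_square)
  have p: "p\<^sup>2 dvd q - 1"
    using root_p [OF _ u] v(2) assms(2) by (metis cong_sym cong_trans)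
  obtain a where a: "[u = t ^ a] (mod q)" using root_t [OF p u] by blast
  have v': "[v = t ^ (p * a)] (mod q)"
    using cong_trans [OF cong_sym [OF v(2)] cong_pow [OF a, of p]]
    by (simp add: power_mult [symmetric] mult.commute)
  have "\<not> p dvd a"
  proof
    assume "p dvd a"
    then have "[t ^ (p * a) = 1] (mod q)" using t_cong_1 [OF p] by (simp add: power2_eq_square)
    then show False using v' assms(2) by (metis cong_trans)
  qed
  then show thesis using that p a v' by blast
qed

text \<open>e = 1 requires l = k, while c = 0 leaves \<open>k\<close> free; for nontrivial v,
  inverting the exponent of u modulo p^2 normalizes u and v at once.\<close>

lemma complete_10:
  assumes "(1, 0, u, v) \<in> basis_params p q A"
  shows "\<exists>s \<in> S10. (1, 0, s) \<in> basis_params p q A"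
proof (cases "[v = 1] (mod q)")
  case True
  then show ?thesis using complete_c0_v1 [OF assms] by (fastforce simp: S10_def)
next
  case False
  then obtain a where p: "p\<^sup>2 dvd q - 1" and a: "\<not> p dvd a" "[u = t ^ a] (mod q)" "[v = t ^ (p * a)] (mod q)"
    using complete_1_v [OF assms] by metis
  have "coprime a (p\<^sup>2)" using not_dvd_coprime [OF a(1)] by simp
  then obtain k where k: "[a * k = 1] (mod p\<^sup>2)"
    using cong_solve_coprime_nat [of a "p\<^sup>2"] by auto
  have "[a * k = 1] (mod p)" using k by (rule cong_dvd_modulus_nat) simp
  then have "coprime (a * k) p" using cong_imp_coprime [OF cong_sym] by fastforce
  then have kp: "coprime k p" by simp
  have tk: "[t ^ (j * (a * k)) = t ^ j] (mod q)" for j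
    using t_cong [OF p] cong_mult [OF cong_refl k, of j] by simp
  have "[u ^ k = t ^ (1 * (a * k))] (mod q)"
    using cong_pow [OF a(2), of k] by (simp add: power_mult)
  then have "[t = u ^ k] (mod q)"
    using cong_sym [OF cong_trans [OF _ tk [of 1]]] by simp
  moreover have "[v ^ k = t ^ (p * (a * k))] (mod q)"
    using cong_pow [OF a(3), of k] by (simp add: power_mult [symmetric] mult.assoc)
  then have "[t ^ p = v ^ k] (mod q)"
    using cong_sym [OF cong_trans [OF _ tk [of p]]] by simp
  ultimately have "(1, 0, t, t ^ p) \<in> basis_params p q A"
    using kp by (intro basis_params_change [OF assms, of k k _ _ _ 0]) simp_all
  then show ?thesis using p by (auto simp: S10_def)
qed

text \<open>Scaling is rigid here, but adding m copies of h to g multiplies u by v^m. For nontrivial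
  v this shifts the exponent of u by multiples of p, leaving its residue modulo p.\<close>

lemma complete_11:
  assumes "(1, 1, u, v) \<in> basis_params p q A"
  shows "\<exists>s \<in> S11. (1, 1, s) \<in> basis_params p q A"
proof (cases "[v = 1] (mod q)")
  case True
  have "[u ^ p = v] (mod q)"
    using basis_params_cong [OF assms] by simp
  then have "[u ^ p = 1] (mod q)" using True by (rule cong_trans)
  then have "u mod q \<in> U" using q_gt_1 by (simp add: U_def cong_def power_mod)
  moreover have "(1, 1, u mod q, 1) \<in> basis_params p q A"
    using True by (intro basis_params_change [OF assms, of 1 1 _ _ _ 0])
      (simp_all add: cong_sym numeral_2_eq_2)
  ultimately show ?thesis by (auto simp: S11_def)
next
  case False
  then obtain a where p: "p\<^sup>2 dvd q - 1" and a: "\<not> p dvd a" "[u = t ^ a] (mod q)" "[v = t ^ (p * a)] (mod q)"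
    using complete_1_v [OF assms] by metis
  let ?r = "a mod p"
  have r: "?r \<in> {1..<p}" using a(1) p_pos by (simp add: mod_greater_zero_iff_not_dvd Suc_le_eq)
  \<comment> \<open>\<open>m\<close> makes \<open>a * m\<close> cancel the quotient
    \<open>a div p\<close> modulo p, so that only the remainder of \<open>a\<close> is left modulo
    p^2.\<close>
  obtain m where "[a * m + a div p = 0] (mod p)"
    using cong_linear_nat [OF not_dvd_coprime [OF a(1)] p_pos] by metis
  then obtain s where s: "a * m + a div p = p * s" by (auto simp: cong_0_iff)
  have "a + p * a * m = ?r + p * (a * m + a div p)" by (simp add: algebra_simps)
  also have "\<dots> = ?r + p\<^sup>2 * s" by (simp add: s power2_eq_square)
  finally have "[a + p * a * m = ?r] (mod p\<^sup>2)" by (simp add: cong_def)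
  then have "[t ^ (a + p * a * m) = t ^ ?r] (mod q)" using t_cong [OF p] by blast
  moreover have "[u * v ^ m = t ^ (a + p * a * m)] (mod q)"
    using cong_mult [OF a(2) cong_pow [OF a(3), of m]] by (simp add: power_add power_mult)
  ultimately have "[t ^ ?r = u * v ^ m] (mod q)" by (metis cong_sym cong_trans)
  moreover have "[t ^ (p * ?r) = v] (mod q)"
  proof -
    have "p * a = p * ?r + p\<^sup>2 * (a div p)"
      by (metis add.commute distrib_left mult.assoc mult_div_mod_eq power2_eq_square)
    then have "[p * a = p * ?r] (mod p\<^sup>2)" by (simp add: cong_def)
    then have "[t ^ (p * a) = t ^ (p * ?r)] (mod q)" using t_cong [OF p] by blast
    then show ?thesis using a(3) by (metis cong_sym cong_trans)
  qed
  ultimately have "(1, 1, t ^ ?r, t ^ (p * ?r)) \<in> basis_params p q A"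
    by (intro basis_params_change [OF assms, of 1 1 _ _ _ m]) (simp_all add: numeral_2_eq_2)
  then show ?thesis using p r unfolding S11_def by auto
qed

lemma complete:
  assumes "basis_params p q A \<noteq> {}"
  shows "basis_params p q A \<inter> normal_forms \<noteq> {}"
proof -
  obtain e c u v where "(e, c, u, v) \<in> basis_params p q A" using assms by auto
  then obtain e c u v where "e \<in> {0, 1}" "c \<in> {0, 1}" and *: "(e, c, u, v) \<in> basis_params p q A"
    by (rule normalize_e_c)
  then consider "e = 0" "c = 0" | "e = 0" "c = 1" | "e = 1" "c = 0" | "e = 1" "c = 1" by auto
  then show ?thesis
  proof cases
    case 1 then show ?thesis using complete_00 * by (fastforce simp: normal_forms_def)
  next
    case 2 then show ?thesis using complete_01 * by (fastforce simp: normal_forms_def)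
  next
    case 3 then show ?thesis using complete_10 * by (fastforce simp: normal_forms_def)
  next
    case 4 then show ?thesis using complete_11 * by (fastforce simp: normal_forms_def)
  qed
qed

section \<open>Uniqueness of the normal form\<close>

lemma second_trivial:
  assumes "(e, c, 1, 1) \<in> basis_params p q A" "(e', c', u', v') \<in> basis_params p q A"
  shows "[u' = 1] (mod q)"
  using basis_params_second(3) [OF assms] by simp

lemma second_v1:
  assumes "(e, c, u, 1) \<in> basis_params p q A" "(e', c', u', v') \<in> basis_params p q A" "[u ^ p = 1] (mod q)"
  shows "[u' ^ p = 1] (mod q)"
proof -
  obtain k m where "[u' = u ^ k * 1 ^ m] (mod q)"
    using basis_params_second(3) [OF assms(1,2)] by blast
  then have "[u' ^ p = (u ^ p) ^ k] (mod q)"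
    using cong_pow [of u' "u ^ k" q p] by (simp add: power_mult [symmetric] mult.commute)
  then show ?thesis using pow_cong_1 [OF assms(3)] by (rule cong_trans)
qed

text \<open>The pairs in \<open>S10\<close> generate groups of exponent 1, p and p^2 modulo q, which
  \<open>second_trivial\<close> and \<open>second_v1\<close> tell apart. \<open>S10\<close> also
  contains \<open>S00\<close>, so e = 0 is covered.\<close>

lemma unique_0:
  assumes "(e, 0, u, v) \<in> basis_params p q A" "(e, 0, u', v') \<in> basis_params p q A"
    "(u, v) \<in> S10" "(u', v') \<in> S10"
  shows "(u, v) = (u', v')"
proof -
  have w1: "\<not> [w = 1] (mod q)" "[w ^ p = 1] (mod q)" if "p dvd q - 1"
    using w_not_cong_1 [OF that] w_cong_1 [OF that] by simp_all
  have t1: "\<not> [t ^ p = 1] (mod q)" if "p\<^sup>2 dvd q - 1"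
    using t_pow_p_not_1 [OF that, of 1] p_gt_1 by simp
  have t2: "\<not> [t = 1] (mod q)" if "p\<^sup>2 dvd q - 1"
    using t1 [OF that] pow_cong_1 by blast
  show ?thesis
    using assms second_trivial [of e 0 A e 0 u' v'] second_trivial [of e 0 A e 0 u v]
      second_v1 [of e 0 u A e 0 u' v'] second_v1 [of e 0 u' A e 0 u v] w1 t1 t2
    by (auto simp: S10_def split: if_splits)
qed

text \<open>The exponent of v changes by a square: triviality of v is preserved and \<open>w\<close>
  cannot become \<open>w ^ n\<close>. Among pairs with v = 1, \<open>second_trivial\<close>
  separates u = 1 from u = w.\<close>

lemma unique_01:
  assumes "(0, 1, u, v) \<in> basis_params p q A" "(0, 1, u', v') \<in> basis_params p q A"
    "(u, v) \<in> S01" "(u', v') \<in> S01"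
  shows "(u, v) = (u', v')"
proof -
  have w1: "\<not> [w = 1] (mod q)" "\<not> [w ^ n = 1] (mod q)" if "p dvd q - 1"
    using w_not_cong_1 [OF that] w_cong_1 [OF that] n_props by simp_all
  have sq: "\<exists>k. \<not> p dvd k \<and> [v' = v ^ (k * k)] (mod q)" "\<exists>k. \<not> p dvd k \<and> [v = v' ^ (k * k)] (mod q)"
    using basis_params_second(4) [OF assms(1,2)] basis_params_second(4) [OF assms(2,1)] by auto
  then have v1: "v = 1 \<Longrightarrow> [v' = 1] (mod q)" "v' = 1 \<Longrightarrow> [v = 1] (mod q)" by auto
  have ns: False if "p dvd q - 1" "[w ^ n = w ^ (k * k)] (mod q)" for k
    using w_cong [OF that(1)] that(2) nonsquare [of k] cong_sym by blast
  have wn: "\<not> (v = w \<and> v' = w ^ n)" "\<not> (v' = w \<and> v = w ^ n)" if "p dvd q - 1"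
    using ns [OF that] sq by auto
  show ?thesis
    using assms second_trivial [of 0 1 A 0 1 u' v'] second_trivial [of 0 1 A 0 1 u v] w1 v1 wn
    by (auto simp: S01_def split: if_splits)
qed

text \<open>e = c = 1 for both bases gives k = k^2, so k = 1 modulo p and v' = v. A nontrivial v =
  t^(p r) determines r and with it u; for trivial v also u' = u^k = u.\<close>

lemma unique_11:
  assumes "(1, 1, u, v) \<in> basis_params p q A" "(1, 1, u', v') \<in> basis_params p q A"
    "(u, v) \<in> S11" "(u', v') \<in> S11"
  shows "(u, v) = (u', v')"
proof -
  obtain k m where k: "\<not> p dvd k" "[u' = u ^ k * v ^ m] (mod q)" "[v' = v ^ (k * k)] (mod q)"
    "[k = k * k] (mod p)"
    using basis_params_second(4) [OF assms(1,2)] by auto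
  have "[k * k = k * 1] (mod p)" using k(4) by (simp add: cong_sym)
  then have k1: "[k = 1] (mod p)"
    using cong_mult_lcancel_nat [of k p k 1] not_dvd_coprime [OF k(1)] by blast
  have cong_k: "[x ^ k = x] (mod q)" if "[x ^ p = 1] (mod q)" for x
  proof -
    have "ord q x dvd p" using that by (simp only: ord_divides)
    with k1 have "[k = 1] (mod ord q x)" by (rule cong_dvd_modulus_nat)
    moreover have "coprime q x" using root_coprime [OF that p_pos] by (simp add: coprime_commute)
    ultimately show ?thesis using order_divides_expdiff [of q x k 1] by simp
  qed
  have vp: "[v ^ p = 1] (mod q)" by (rule basis_params_cong [OF assms(1)])
  have "[v ^ (k * k) = v ^ k] (mod q)"
    using cong_pow [OF cong_k [OF vp], of k] by (simp add: power_mult)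
  then have v': "[v' = v] (mod q)"
    using k(3) cong_k [OF vp] by (metis cong_trans)
  show ?thesis
  proof (cases "v = 1 \<or> v' = 1")
    case True
    have not_t: "\<not> (p\<^sup>2 dvd q - 1 \<and> (\<exists>r\<in>{1..<p}. x = t ^ (p * r)))" if "[x = 1] (mod q)" for x
      using t_pow_p_not_1 that by auto
    have "[v = 1] (mod q)" "[v' = 1] (mod q)"
      using True v' by (auto simp: cong_sym)
    then have vv: "v = 1" "v' = 1" "u \<in> U" "u' \<in> U"
      using assms(3,4) not_t [of v] not_t [of v'] by (auto simp: S11_def split: if_splits)
    then have "[u' = u ^ k] (mod q)" using k(2) by simp
    moreover have "[u ^ k = u] (mod q)" using vv by (intro cong_k) (simp add: U_def)
    ultimately have "[u' = u] (mod q)" by (rule cong_trans)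
    then show ?thesis using vv cong_less_modulus_unique_nat [of u' u q] by (simp add: U_def)
  next
    case False
    then have p: "p\<^sup>2 dvd q - 1" using assms(3) by (auto simp: S11_def split: if_splits)
    obtain r s where rs: "r \<in> {1..<p}" "s \<in> {1..<p}" "(u, v) = (t ^ r, t ^ (p * r))" "(u', v') = (t ^ s, t ^ (p * s))"
      using False assms(3,4) p by (auto simp: S11_def)
    then have "[p * s = p * r] (mod p\<^sup>2)" using v' t_cong [OF p] by simp
    then have "[s = r] (mod p)" using p_pos by (simp add: cong_def power2_eq_square)
    then have "s = r" using rs by (simp add: cong_less_modulus_unique_nat)
    then show ?thesis using rs by simp
  qed
qed

lemma unique:
  assumes "i \<in> basis_params p q A \<inter> normal_forms" "j \<in> basis_params p q A \<inter> normal_forms"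
  shows "i = j"
proof -
  obtain e c u v where i: "i = (e, c, u, v)" by (cases i)
  obtain e' c' u' v' where j: "j = (e', c', u', v')" by (cases j)
  have ij: "(e, c, u, v) \<in> basis_params p q A" "(e', c', u', v') \<in> basis_params p q A"
    "(e, c, u, v) \<in> normal_forms" "(e', c', u', v') \<in> normal_forms"
    using assms by (simp_all add: i j)
  have le: "e \<in> {0, 1}" "c \<in> {0, 1}" "e' \<in> {0, 1}" "c' \<in> {0, 1}"
    using ij(3,4) by (auto simp: normal_forms_def)
  have "e = 0 \<longleftrightarrow> e' = 0" "c = 0 \<longleftrightarrow> c' = 0"
    using basis_params_second(1,2) [OF ij(1,2)] basis_params_second(1,2) [OF ij(2,1)] le p_gt_1 by auto
  then have ec: "e' = e" "c' = c" using le by auto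
  have S00: "S00 \<subseteq> S10" by (auto simp: S00_def S10_def)
  have "(u, v) = (u', v')"
  proof (cases "c = 0")
    case True
    then have "(u, v) \<in> S10" "(u', v') \<in> S10"
      using ij(3,4) S00 by (auto simp: ec normal_forms_def)
    then show ?thesis using unique_0 ij(1,2) True by (simp add: ec)
  next
    case False
    then have c: "c = 1" using le by simp
    show ?thesis
    proof (cases "e = 0")
      case True
      then show ?thesis using ij unique_01 by (simp add: ec c normal_forms_def)
    next
      case False
      then have "e = 1" using le by simp
      then show ?thesis using ij unique_11 by (simp add: ec c normal_forms_def)
    qed
  qed
  then show ?thesis by (simp add: i j ec)
qed

theorem num_braces_normal_forms: "num_braces (p\<^sup>2 * q) = card normal_forms"
proof (rule num_braces_eq_card [where S = "basis_params p q"])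
  show "\<exists>A \<in> braces_of_order (p\<^sup>2 * q). i \<in> basis_params p q A" if "i \<in> normal_forms" for i
  proof -
    obtain e c u v where i: "i = (e, c, u, v)" by (cases i)
    show ?thesis
      unfolding i using that
      by (intro basis_params_realized prime_p prime_q p_gt_2 p_less_q valid) (simp_all add: i)
  qed
  show "basis_params p q A \<inter> normal_forms \<noteq> {}" if "A \<in> braces_of_order (p\<^sup>2 * q)" for A
    using complete basis_params_nonempty prime_p prime_q p_gt_2 p_less_q that by blast
next
  fix A B :: "nat ring" and i
  assume "i \<in> basis_params p q A" "i \<in> basis_params p q B"
  then show "brace_iso A B \<noteq> {}" by (rule basis_params_iso)
next
  fix A B :: "nat ring"
  assume "B \<in> braces_of_order (p\<^sup>2 * q)" "brace_iso A B \<noteq> {}"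
  then show "basis_params p q A \<subseteq> basis_params p q B"
    by (intro basis_params_mono) (simp add: braces_of_order_def)
qed (rule unique)

end

theorem corollary3:
  fixes p q :: nat
  assumes "prime p" and "prime q" and "2 < p" and "p < q"
  shows "(\<not> p dvd q - 1 \<longrightarrow> num_braces (p\<^sup>2 * q) = 4) \<and>
         (p dvd q - 1 \<and> \<not> p\<^sup>2 dvd q - 1 \<longrightarrow> num_braces (p\<^sup>2 * q) = p + 8) \<and>
         (p\<^sup>2 dvd q - 1 \<longrightarrow> num_braces (p\<^sup>2 * q) = 2 * p + 8)"
proof -
  have "\<exists>w. ord q w = d \<and> (\<forall>x. [x ^ d = 1] (mod q) \<longrightarrow> (\<exists>r. [x = w ^ r] (mod q)))"
    if "d dvd q - 1" for d
    using prime_root_of_unity [OF assms(2) that] by metis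
  \<comment> \<open>One choice function makes \<open>f p\<close> and \<open>f (p\<^sup>2)\<close>
    available in all cases, with properties conditional on divisibility as in the locale.\<close>
  then obtain f where f: "\<And>d. d dvd q - 1 \<Longrightarrow>
      ord q (f d) = d \<and> (\<forall>x. [x ^ d = 1] (mod q) \<longrightarrow> (\<exists>r. [x = f d ^ r] (mod q)))"
    by metis
  obtain n where n: "\<And>k. \<not> [k * k = n] (mod p)"
    "\<And>b. \<not> p dvd b \<Longrightarrow> \<exists>k. \<not> p dvd k \<and> ([b * (k * k) = 1] (mod p) \<or> [b * (k * k) = n] (mod p))"
    using prime_nonsquare [OF assms(1,3)] by metis
  interpret normal_params p q "f p" "f (p\<^sup>2)" n
    by unfold_locales (use assms f n in blast)+
  show ?thesis
    using p2_imp_p by (simp add: num_braces_normal_forms card_normal_forms_eq)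
qed

end
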